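(* The edge generating series of the Grand Schröder lattices is $$\sum_{n\ge0}\ell(\mathcal{GS}_n)x^n=\frac{2(x-x^2)}{(1-6x+x^2)^{3/2}}.$$ Moreover, for every $n\ge0$, $$\ell(\mathcal{GS}_n)=2\sum_{k=0}^n\binom{n+k}{2k}\binom{2k}{k}(n-k)=\sum_{k=0}^{\lfloor n/2\rfloor}\binom nk\binom{n-k}{k}\frac{(n-2k)(n+k+2)}{k+1}\,2^{k+1}3^{n-2k-2}.$$ Finally, $\ell(\mathcal{GS}_n)\sim\sqrt{\frac{n}{2\sqrt2\,\pi}}\,(1+\sqrt2)^{2n}$ and $i(\mathcal{GS}_n)=\ell(\mathcal{GS}_n)/|\mathcal{GS}_n|\sim(2-\sqrt2)n$.
   Context: Steps: $U=(1,1)$, $D=(1,-1)$, $H=(2,0)$. $\mathcal{GS}_n$ is the set of all lattice paths from $(0,0)$ to $(2n,0)$ with steps $U,D,H$, partially ordered by $\gamma_1\le\gamma_2$ iff $\gamma_1$ lies weakly below $\gamma_2$. $\ell(P)$ is the number of edges (covering pairs) of the Hasse diagram of a finite poset $P$ and $i(P)=\ell(P)/|P|$. $|\mathcal{GS}_n|$ equals the central Delannoy number $d_n$, with $\sum_nd_nx^n=1/\sqrt{1-6x+x^2}$. $a_n\sim b_n$ means $a_n/b_n\to1$. *)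

theory Defs
  imports "HOL-Analysis.Analysis" "HOL-Library.Landau_Symbols"
begin

datatype step = U | D | H

fun step_len :: "step \<Rightarrow> nat" where
  "step_len U = 1" | "step_len D = 1" | "step_len H = 2"

fun step_rise :: "step \<Rightarrow> int" where
  "step_rise U = 1" | "step_rise D = -1" | "step_rise H = 0"

definition path_len :: "step list \<Rightarrow> nat" where
  "path_len p = sum_list (map step_len p)"

definition path_end :: "step list \<Rightarrow> int" where
  "path_end p = sum_list (map step_rise p)"

fun ht :: "step list \<Rightarrow> real \<Rightarrow> real" where
  "ht [] t = 0"
| "ht (U # p) t = (if t \<le> 1 then t else 1 + ht p (t - 1))"
| "ht (D # p) t = (if t \<le> 1 then - t else - 1 + ht p (t - 1))"
| "ht (H # p) t = (if t \<le> 2 then 0 else ht p (t - 2))"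

definition GS :: "nat \<Rightarrow> step list set" where
  "GS n = {p. path_len p = 2 * n \<and> path_end p = 0}"

definition GS_le :: "nat \<Rightarrow> step list \<Rightarrow> step list \<Rightarrow> bool" where
  "GS_le n p q \<longleftrightarrow> (\<forall>t\<in>{0..real (2 * n)}. ht p t \<le> ht q t)"

definition GS_less :: "nat \<Rightarrow> step list \<Rightarrow> step list \<Rightarrow> bool" where
  "GS_less n p q \<longleftrightarrow> GS_le n p q \<and> p \<noteq> q"

definition GS_covers :: "nat \<Rightarrow> (step list \<times> step list) set" where
  "GS_covers n = {(p, q). p \<in> GS n \<and> q \<in> GS n \<and> GS_less n p q \<and>
      \<not> (\<exists>r\<in>GS n. GS_less n p r \<and> GS_less n r q)}"

definition ell :: "nat \<Rightarrow> nat" where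
  "ell n = card (GS_covers n)"

end

(* A covering pair of GS n is one local move, DU -> H or H -> UD, each raising the height of the path by
   one at a single integer abscissa. Moves of either kind correspond to marked H steps, so ell n is
   twice the number of H steps in all paths, which gives the first sum. Writing q(n) for the
   coefficient of x^(n-1) in (1 - 6 x + x^2)^(-3/2), this sum is 2 (q(n) - q(n-1)) by Pascal's
   rule. Expanding 1 - 6 x + x^2 as (1 - x)^2 - 4 x and as (1 - 3 x)^2 - 8 x^2 yields the two sums;
   factoring it as (1 - root_hi x) (1 - root_lo x) turns q(n) into a convolution whose asymptotics
   follow from Tannery's theorem. The ratio needs no separate asymptotics for card (GS n), because
   2 n card (GS n) = ell n + 4 q(n). *)
theory Submission
  imports Defs "HOL-Combinatorics.Multiset_Permutations" "HOL-Real_Asymp.Real_Asymp"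
begin

section \<open>Paths as integer height functions\<close>

text \<open>All vertices of a path, and also the midpoint of each \<open>H\<close>, have integer
  abscissae. So the order, defined through real abscissae, is pointwise comparison of integer
  sequences, and a change by one at a single place leaves no room for an intermediate path. The
  harder half of the cover description is that nothing but a local move is a cover: whenever one
  path lies strictly below another, some move on the lower path must stay below the upper one. The
  first place where the two paths differ need not admit such a move. The asymptotic constants come
  from the singularity \<open>3 - 2 * sqrt 2\<close> of the generating function, whose reciprocal is
  \<open>(1 + sqrt 2)^2\<close>. The exponent -3/2 contributes the factor \<open>sqrt n\<close> and
  the value 1 / Gamma(3/2) = 2 / sqrt pi. With r = 2 (1 - root_lo) = 4 sqrt 2 - 4 as the limit of
  \<open>ell n / quad_coeff n\<close>, the identity for the ratio yields the limit 2 r / (r + 4) = 2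
  - sqrt 2 of \<open>ell n / (n * card (GS n))\<close>.\<close>

fun height :: "step list \<Rightarrow> nat \<Rightarrow> int" where
  "height [] i = 0"
| "height (U # p) i = (case i of 0 \<Rightarrow> 0 | Suc j \<Rightarrow> 1 + height p j)"
| "height (D # p) i = (case i of 0 \<Rightarrow> 0 | Suc j \<Rightarrow> - 1 + height p j)"
| "height (H # p) i = (case i of 0 \<Rightarrow> 0 | Suc 0 \<Rightarrow> 0 | Suc (Suc j) \<Rightarrow> height p j)"

lemma path_len_simps [simp]:
  "path_len [] = 0" "path_len (s # p) = step_len s + path_len p"
  "path_len (p @ q) = path_len p + path_len q"
  by (simp_all add: path_len_def)

lemma path_end_simps [simp]:
  "path_end [] = 0" "path_end (s # p) = step_rise s + path_end p"
  "path_end (p @ q) = path_end p + path_end q"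
  by (simp_all add: path_end_def)

lemma height_0 [simp]: "height p 0 = 0"
  by (induction p "0::nat" rule: height.induct) auto

lemma ht_0 [simp]: "ht p 0 = 0"
  by (cases "(p, 0::real)" rule: ht.cases) auto

text \<open>Every step is affine between consecutive integers. No bound on \<open>i\<close> is
  needed because both height functions stay constant beyond the end of the path.\<close>

lemma ht_interpolation:
  assumes "0 \<le> f" "f \<le> 1"
  shows "ht p (real i + f) = (1 - f) * of_int (height p i) + f * of_int (height p (Suc i))"
proof (induction p i rule: height.induct)
  case (1 i)
  then show ?case by simp
next
  case (2 p i)
  show ?case
  proof (cases i)
    case (Suc j)
    show ?thesis
    \<comment> \<open>At the vertex \<open>t = 1\<close> itself \<open>ht\<close> still takes its
      first branch, so the recursive equation applies only to the right of it.\<close>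
    proof (cases "j = 0 \<and> f = 0")
      case False
      then have "\<not> real i + f \<le> 1" using Suc assms by auto
      then show ?thesis using 2[OF Suc] Suc by (simp add: algebra_simps)
    qed (simp add: Suc)
  qed (use assms in simp)
next
  case (3 p i)
  show ?case
  proof (cases i)
    case (Suc j)
    show ?thesis
    proof (cases "j = 0 \<and> f = 0")
      case False
      then have "\<not> real i + f \<le> 1" using Suc assms by auto
      then show ?thesis using 3[OF Suc] Suc by (simp add: algebra_simps)
    qed (simp add: Suc)
  qed (use assms in simp)
next
  case (4 p i)
  consider "i = 0" | "i = 1" | j where "i = Suc (Suc j)"
    by (metis One_nat_def not0_implies_Suc)
  then show ?case
  proof cases
    case 3
    show ?thesis
    proof (cases "j = 0 \<and> f = 0")
      case False
      then have "\<not> real i + f \<le> 2" using 3 assms by auto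
      then show ?thesis using 4[of "Suc j" j] 3 by (simp add: algebra_simps)
    qed (simp add: 3)
  qed (use assms in auto)
qed

lemma ht_of_nat: "ht p (real i) = of_int (height p i)"
  using ht_interpolation[of 0 p i] by simp

lemma GS_le_iff_height: "GS_le n p q \<longleftrightarrow> (\<forall>i\<le>2 * n. height p i \<le> height q i)"
proof
  assume *: "GS_le n p q"
  show "\<forall>i\<le>2 * n. height p i \<le> height q i"
  proof (intro allI impI)
    fix i assume "i \<le> 2 * n"
    with * have "ht p (real i) \<le> ht q (real i)"
      unfolding GS_le_def by (auto simp del: of_nat_mult)
    then show "height p i \<le> height q i" by (simp add: ht_of_nat)
  qed
next
  assume *: "\<forall>i\<le>2 * n. height p i \<le> height q i"
  show "GS_le n p q"
    unfolding GS_le_def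
  proof
    fix t assume t: "t \<in> {0..real (2 * n)}"
    define i where "i = nat \<lfloor>t\<rfloor>"
    define f where "f = t - real i"
    have f: "0 \<le> f" "f < 1" and ti: "t = real i + f"
    proof -
      have "real i = of_int \<lfloor>t\<rfloor>" using t unfolding i_def by simp
      then show "0 \<le> f" "f < 1" "t = real i + f"
        unfolding f_def by linarith+
    qed
    show "ht p t \<le> ht q t"
    \<comment> \<open>At \<open>t = 2 * n\<close> the right neighbour \<open>Suc i\<close> would
      leave the range of the hypothesis; a positive fractional part excludes this.\<close>
    proof (cases "f = 0")
      case True
      with ti t * show ?thesis
        by (simp add: ht_of_nat del: of_nat_mult)
    next
      case False
      then have "Suc i \<le> 2 * n"
        using f ti t by (simp del: of_nat_mult)
      with * have "height p i \<le> height q i" "height p (Suc i) \<le> height q (Suc i)"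
        by simp_all
      then show ?thesis
        unfolding ti using f by (simp add: ht_interpolation add_mono mult_left_mono)
    qed
  qed
qed

lemma height_append:
  "height (u @ v) i =
     (if i \<le> path_len u then height u i else path_end u + height v (i - path_len u))"
proof (induction u i rule: height.induct)
  case (1 i)
  then show ?case by simp
next
  case (2 p i)
  then show ?case by (cases i) auto
next
  case (3 p i)
  then show ?case by (cases i) auto
next
  case (4 p i)
  then show ?case by (auto split: nat.splits)
qed

lemma height_path_len [simp]: "height p (path_len p) = path_end p"
proof (induction p)
  case (Cons s p)
  then show ?case by (cases s) auto
qed simp

lemma height_ge: "- int i \<le> height p i"
  by (induction p i rule: height.induct) (auto split: nat.splits)

lemma path_len_eq_0_iff [simp]: "path_len p = 0 \<longleftrightarrow> p = []"
proof (cases p)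
  case (Cons s q)
  then show ?thesis by (cases s) auto
qed simp

text \<open>The height at abscissa 1 is 1, -1 or 0 according to whether the path starts with
  \<open>U\<close>, \<open>D\<close> or \<open>H\<close>, so the steps can be read off one after the
  other. This gives antisymmetry of the order.\<close>

lemma height_inject:
  assumes "path_len p = path_len q"
    and "\<And>i. i \<le> path_len p \<Longrightarrow> height p i = height q i"
  shows "p = q"
  using assms
proof (induction p arbitrary: q)
  case Nil
  then show ?case by (metis path_len_eq_0_iff)
next
  case (Cons s p)
  from Cons.prems(1) obtain s' q' where q: "q = s' # q'"
    by (metis path_len_eq_0_iff list.exhaust)
  have "s = s'"
    using Cons.prems(2)[of 1] unfolding q by (cases s; cases s') auto
  moreover have "p = q'"
  proof (rule Cons.IH)
    show "path_len p = path_len q'" using Cons.prems(1) q \<open>s = s'\<close> by simp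
  next
    fix i assume "i \<le> path_len p"
    then show "height p i = height q' i"
      using Cons.prems(2)[of "step_len s + i"] unfolding q \<open>s = s'\<close> by (cases s') auto
  qed
  ultimately show ?case using q by simp
qed

text \<open>The exceptional abscissa is the midpoint of the \<open>H\<close> step, where the peak
  has its apex and, in the next lemma, the valley its bottom.\<close>

lemma height_peak:
  "height (u @ U # D # v) i = height (u @ H # v) i + (if i = Suc (path_len u) then 1 else 0)"
  by (auto simp: height_append not_le split: nat.splits)

lemma height_valley:
  "height (u @ H # v) i = height (u @ D # U # v) i + (if i = Suc (path_len u) then 1 else 0)"
  by (auto simp: height_append not_le split: nat.splits)

section \<open>Covering pairs\<close>

definition raises :: "step list \<Rightarrow> step list \<Rightarrow> bool" where
  "raises p q \<longleftrightarrow> (\<exists>u v. p = u @ H # v \<and> q = u @ U # D # v \<or> p = u @ D # U # v \<and> q = u @ H # v)"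

lemma raises_height:
  assumes "raises p q"
  obtains j where "j \<le> path_len p" "\<And>i. height q i = height p i + (if i = j then 1 else 0)"
  using assms unfolding raises_def
proof (elim exE disjE conjE)
  fix u v assume "p = u @ H # v" "q = u @ U # D # v"
  then show thesis using that[of "Suc (path_len u)"] by (simp add: height_peak)
next
  fix u v assume "p = u @ D # U # v" "q = u @ H # v"
  then show thesis using that[of "Suc (path_len u)"] by (simp add: height_valley)
qed

lemma raises_append: "raises p q \<Longrightarrow> raises (w @ p) (w @ q)"
  unfolding raises_def
proof (elim exE disjE conjE)
  fix u v assume "p = u @ H # v" "q = u @ U # D # v"
  then show "\<exists>u v. w @ p = u @ H # v \<and> w @ q = u @ U # D # v \<or> w @ p = u @ D # U # v \<and> w @ q = u @ H # v"
    by (intro exI[of _ "w @ u"] exI[of _ v]) simp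
next
  fix u v assume "p = u @ D # U # v" "q = u @ H # v"
  then show "\<exists>u v. w @ p = u @ H # v \<and> w @ q = u @ U # D # v \<or> w @ p = u @ D # U # v \<and> w @ q = u @ H # v"
    by (intro exI[of _ "w @ u"] exI[of _ v]) simp
qed

lemma raises_path_len: "raises p q \<Longrightarrow> path_len q = path_len p"
  and raises_path_end: "raises p q \<Longrightarrow> path_end q = path_end p"
  unfolding raises_def by auto

lemma raises_GS_iff: "raises p q \<Longrightarrow> p \<in> GS n \<longleftrightarrow> q \<in> GS n"
  by (simp add: GS_def raises_path_len raises_path_end)

section \<open>Existence of a move on the lower path that stays below the upper path\<close>

lemma height_replicate_D_append:
  "height (replicate j D @ r) i = (if i \<le> j then - int i else - int j + height r (i - j))"
proof (induction j arbitrary: i)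
  case (Suc j)
  then show ?case by (cases i) auto
qed simp

text \<open>The extreme height \<open>- int i\<close> is reached only by descending all the time. A
  first step \<open>U\<close> gains two over it; a first step \<open>H\<close> gains one at its
  midpoint and two from its end on.\<close>

lemma height_ge_hd_neq_D:
  assumes "q \<noteq> []" "hd q \<noteq> D" "i \<ge> 1"
  shows "height q i \<ge> 1 - int i" "i \<ge> 2 \<Longrightarrow> height q i \<ge> 2 - int i" "hd q = U \<Longrightarrow> height q i \<ge> 2 - int i"
proof -
  obtain s q' where q: "q = s # q'" "s \<noteq> D" using assms by (cases q) auto
  have "height q i \<ge> 1 - int i \<and> (i \<ge> 2 \<longrightarrow> height q i \<ge> 2 - int i) \<and> (s = U \<longrightarrow> height q i \<ge> 2 - int i)"
    using q(2) \<open>i \<ge> 1\<close> height_ge[of "i - 1" q'] height_ge[of "i - 2" q'] unfolding q(1)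
    by (cases s) (auto split: nat.splits)
  then show "height q i \<ge> 1 - int i" "i \<ge> 2 \<Longrightarrow> height q i \<ge> 2 - int i" "hd q = U \<Longrightarrow> height q i \<ge> 2 - int i"
    using q by auto
qed

lemma replicate_D_decomp:
  obtains j r where "p = replicate j D @ r" "r = [] \<or> hd r \<noteq> D"
proof -
  have "\<exists>j r. p = replicate j D @ r \<and> (r = [] \<or> hd r \<noteq> D)"
  proof (induction p)
    case (Cons s p)
    then obtain j r where "p = replicate j D @ r" "r = [] \<or> hd r \<noteq> D" by blast
    then show ?case
      by (cases "s = D") (force intro: exI[of _ "Suc j"] exI[of _ 0])+
  qed simp
  then show thesis using that by blast
qed

text \<open>If the lower path starts with a maximal run of \<open>D\<close> steps, the step after the run can be raised:
  the upper path is at most 1-Lipschitz and starts with \<open>H\<close> or \<open>U\<close>, so it is still strictly above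
  there.\<close>
lemma exists_raise_below_first_step_differs:
  assumes len: "path_len (a # p) = path_len (b # q)" and "end": "path_end (a # p) = path_end (b # q)"
    and le: "\<And>i. i \<le> path_len (a # p) \<Longrightarrow> height (a # p) i \<le> height (b # q) i"
    and "a \<noteq> b"
  shows "\<exists>r. raises (a # p) r \<and> (\<forall>i \<le> path_len (a # p). height r i \<le> height (b # q) i)"
proof -
  have "height (a # p) 1 \<le> height (b # q) 1"
    by (rule le) (cases a; simp)
  \<comment> \<open>The heights at abscissa 1 order the first steps as \<open>D\<close> below
    \<open>H\<close> below \<open>U\<close>.\<close>
  with \<open>a \<noteq> b\<close> have ab: "a = H \<and> b = U \<or> a = D \<and> b \<noteq> D"
    by (cases a; cases b) auto
  have *: ?thesis
    if "raises (a # p) r" "\<And>i. height r i = height (a # p) i + (if i = j then 1 else 0)"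
      "height (a # p) j + 1 \<le> height (b # q) j" for r j
    using that le by (intro exI[of _ r]) auto
  from ab show ?thesis
  proof (elim disjE conjE)
    assume "a = H" "b = U"
    show ?thesis
    proof (rule *)
      show "raises (a # p) ([] @ U # D # p)"
        unfolding raises_def \<open>a = H\<close> by blast
      show "height ([] @ U # D # p) i = height (a # p) i + (if i = 1 then 1 else 0)" for i
        using height_peak[of "[]" p i] \<open>a = H\<close> by simp
    qed (simp add: \<open>a = H\<close> \<open>b = U\<close>)
  next
    assume "a = D" "b \<noteq> D"
    obtain j r where p: "p = replicate j D @ r" "r = [] \<or> hd r \<noteq> D"
      by (rule replicate_D_decomp)
    have ap: "a # p = replicate (Suc j) D @ r" using p \<open>a = D\<close> by simp
    have hap: "height (a # p) i = (if i \<le> Suc j then - int i else - int (Suc j) + height r (i - Suc j))"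
      for i unfolding ap by (rule height_replicate_D_append)
    note low = height_ge_hd_neq_D[of "b # q"]
    have len_rep: "path_len (replicate k D) = k" for k by (induction k) auto
    show ?thesis
    proof (cases r)
      \<comment> \<open>A lower path consisting of \<open>D\<close> only would end at the extreme
        height, which the upper path, of equal length and not starting with \<open>D\<close>, cannot
        reach.\<close>
      case Nil
      have "path_len (a # p) = Suc j" unfolding ap Nil using len_rep[of "Suc j"] by simp
      then have "height (a # p) (Suc j) = height (b # q) (Suc j)"
        using len "end" height_path_len[of "a # p"] height_path_len[of "b # q"] by metis
      then show ?thesis using hap[of "Suc j"] low(1)[of "Suc j"] \<open>b \<noteq> D\<close> by simp
    next
      case (Cons s v)
      show ?thesis
      proof (cases s)
        case U
        have ap': "a # p = replicate j D @ D # U # v"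
          unfolding ap Cons U by (simp add: replicate_append_same flip: replicate_Suc)
        show ?thesis
        proof (rule *)
          show "raises (a # p) (replicate j D @ H # v)"
            unfolding raises_def ap' by blast
          show "height (replicate j D @ H # v) i = height (a # p) i + (if i = Suc j then 1 else 0)" for i
            unfolding ap' using height_valley[of "replicate j D" v i] by (simp add: len_rep)
          show "height (a # p) (Suc j) + 1 \<le> height (b # q) (Suc j)"
            using hap[of "Suc j"] low(1)[of "Suc j"] \<open>b \<noteq> D\<close> by simp
        qed
      next
        case D
        then show ?thesis using p Cons by simp
      next
        case H
        show ?thesis
        proof (rule *)
          show "raises (a # p) (replicate (Suc j) D @ U # D # v)"
            unfolding raises_def ap Cons H by blast
          show "height (replicate (Suc j) D @ U # D # v) i
              = height (a # p) i + (if i = Suc (Suc j) then 1 else 0)" for i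
            unfolding ap Cons H using height_peak[of "replicate (Suc j) D" v i]
            by (simp only: len_rep)
          \<comment> \<open>The midpoint of the \<open>H\<close> after the run lies at abscissa
            \<open>j + 2\<close> and height \<open>-(j + 1)\<close>. The upper path has height at
            least \<open>-j\<close> there, since its first step is not \<open>D\<close>.\<close>
          show "height (a # p) (Suc (Suc j)) + 1 \<le> height (b # q) (Suc (Suc j))"
            using hap[of "Suc (Suc j)"] low(2)[of "Suc (Suc j)"] \<open>b \<noteq> D\<close> Cons H by simp
        qed
      qed
    qed
  qed
qed

text \<open>This forces every cover to be a local move: the raised path lies strictly above
  \<open>p\<close> and weakly below \<open>q\<close>, so it equals \<open>q\<close> if
  \<open>q\<close> covers \<open>p\<close>. Common first steps are stripped, and a move on the tail
  is a move on the whole path.\<close>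

lemma exists_raise_below:
  assumes "path_len p = path_len q" "path_end p = path_end q"
    and "\<And>i. i \<le> path_len p \<Longrightarrow> height p i \<le> height q i" and "p \<noteq> q"
  shows "\<exists>r. raises p r \<and> (\<forall>i \<le> path_len p. height r i \<le> height q i)"
  using assms
proof (induction p arbitrary: q)
  case Nil
  then show ?case by (metis path_len_eq_0_iff)
next
  case (Cons a p)
  from Cons.prems(1) obtain b q' where q: "q = b # q'"
    by (metis path_len_eq_0_iff list.exhaust)
  show ?case
  proof (cases "a = b")
    case False
    then show ?thesis
      using exists_raise_below_first_step_differs Cons.prems unfolding q by blast
  next
    case True
    have "\<exists>r. raises p r \<and> (\<forall>i \<le> path_len p. height r i \<le> height q' i)"
    proof (rule Cons.IH)
      fix i assume "i \<le> path_len p"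
      then show "height p i \<le> height q' i"
        using Cons.prems(3)[of "step_len b + i"] unfolding q True by (cases b) auto
    qed (use Cons.prems q True in auto)
    then obtain r where r: "raises p r" "\<And>i. i \<le> path_len p \<Longrightarrow> height r i \<le> height q' i" by blast
    have "height (a # r) i \<le> height (a # q') i" if "i \<le> path_len (a # p)" for i
      using that r(2)[of "i - step_len a"] by (cases a) (auto split: nat.splits)
    moreover have "raises (a # p) (a # r)"
      using raises_append[OF r(1), of "[a]"] by simp
    ultimately show ?thesis unfolding q True by blast
  qed
qed

lemma GS_covers_eq_raises: "GS_covers n = {(p, q). p \<in> GS n \<and> raises p q}"
proof (intro set_eqI iffI; clarify)
  fix p q assume "(p, q) \<in> GS_covers n"
  then have pq: "p \<in> GS n" "q \<in> GS n" "GS_less n p q"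
    and no: "\<not> (\<exists>r\<in>GS n. GS_less n p r \<and> GS_less n r q)"
    by (auto simp: GS_covers_def)
  obtain r where r: "raises p r" "\<And>i. i \<le> 2 * n \<Longrightarrow> height r i \<le> height q i"
    using exists_raise_below[of p q] pq by (auto simp: GS_def GS_less_def GS_le_iff_height)
  obtain j where j: "j \<le> path_len p" "\<And>i. height r i = height p i + (if i = j then 1 else 0)"
    using raises_height[OF r(1)] by blast
  have "p \<noteq> r" using j(2)[of j] by auto
  then have "GS_less n p r" using j by (auto simp: GS_less_def GS_le_iff_height)
  moreover have "r \<in> GS n" using raises_GS_iff[OF r(1)] pq by simp
  ultimately have "\<not> GS_less n r q" using no by blast
  then have "r = q" using r(2) by (auto simp: GS_less_def GS_le_iff_height)
  with r pq show "p \<in> GS n \<and> raises p q" by simp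
next
  fix p q assume p: "p \<in> GS n" and pq: "raises p q"
  then have q: "q \<in> GS n" using raises_GS_iff by blast
  obtain j where j: "j \<le> path_len p" "\<And>i. height q i = height p i + (if i = j then 1 else 0)"
    using raises_height[OF pq] by blast
  have "p \<noteq> q" using j(2)[of j] by auto
  then have "GS_less n p q" using j by (auto simp: GS_less_def GS_le_iff_height)
  moreover have False if r: "r \<in> GS n" "GS_less n p r" "GS_less n r q" for r
  proof -
    have b: "height p i \<le> height r i" "height r i \<le> height p i + (if i = j then 1 else 0)"
      if "i \<le> 2 * n" for i
      using r that unfolding GS_less_def GS_le_iff_height j(2)[symmetric] by simp_all
    have "j \<le> 2 * n" using j(1) p by (simp add: GS_def)
    from b[OF this] have "height r j = height p j \<or> height r j = height q j" using j(2)[of j] by auto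
    moreover have "height r i = height p i \<and> height r i = height q i" if "i \<le> 2 * n" "i \<noteq> j" for i
      using b[OF that(1)] that(2) j(2)[of i] by auto
    \<comment> \<open>Heights are integers and \<open>p\<close>, \<open>q\<close> differ by one at
      \<open>j\<close> only, so an intermediate path has the heights of one of them
      everywhere.\<close>
    ultimately have "(\<forall>i\<le>2 * n. height p i = height r i) \<or> (\<forall>i\<le>2 * n. height r i = height q i)"
      by metis
    then have "p = r \<or> r = q"
      using height_inject[of p r] height_inject[of r q] p q r(1) by (auto simp: GS_def)
    then show False using r by (auto simp: GS_less_def)
  qed
  ultimately show "(p, q) \<in> GS_covers n"
    unfolding GS_covers_def using p q by blast
qed

section \<open>Counting horizontal steps\<close>

lemma UNIV_step: "(UNIV :: step set) = {U, D, H}"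
  by (auto intro: step.exhaust)

lemma finite_GS: "finite (GS n)"
proof (rule finite_subset)
  have "length p \<le> path_len p" for p
  proof (induction p)
    case (Cons s p)
    then show ?case by (cases s) auto
  qed simp
  then show "GS n \<subseteq> {p. set p \<subseteq> UNIV \<and> length p \<le> 2 * n}"
    by (auto simp: GS_def) metis
  show "finite {p. set p \<subseteq> (UNIV :: step set) \<and> length p \<le> 2 * n}"
    by (rule finite_lists_length_le) (simp add: UNIV_step)
qed

lemma card_marked_H:
  "card {(u, v). u @ H # v \<in> GS n} = (\<Sum>p\<in>GS n. count (mset p) H)"
proof -
  have "card {(u, v). u @ H # v \<in> GS n} = card (SIGMA p:GS n. {i. i < length p \<and> p ! i = H})"
  proof (rule bij_betw_same_card[OF bij_betwI])
    show "(\<lambda>(u, v). (u @ H # v, length u)) \<in>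
        {(u, v). u @ H # v \<in> GS n} \<rightarrow> (SIGMA p:GS n. {i. i < length p \<and> p ! i = H})"
      by auto
    show "(\<lambda>(p, i). (take i p, drop (Suc i) p)) \<in>
        (SIGMA p:GS n. {i. i < length p \<and> p ! i = H}) \<rightarrow> {(u, v). u @ H # v \<in> GS n}"
      by (auto simp: id_take_nth_drop[symmetric] dest: id_take_nth_drop)
  qed (auto simp: id_take_nth_drop[symmetric] dest: id_take_nth_drop)
  also have "\<dots> = (\<Sum>p\<in>GS n. card {i. i < length p \<and> p ! i = H})"
    using finite_GS by (subst card_SigmaI) auto
  also have "\<dots> = (\<Sum>p\<in>GS n. count (mset p) H)"
    by (simp add: count_mset count_list_eq_length_filter length_filter_conv_card eq_commute[of H])
  finally show ?thesis .
qed

lemma finite_marked_H: "finite {(u, v). u @ H # v \<in> GS n}"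
proof (rule finite_subset)
  show "{(u, v). u @ H # v \<in> GS n} \<subseteq>
    (\<lambda>(p, i). (take i p, drop (Suc i) p)) ` (SIGMA p:GS n. {..<length p})"
  proof clarify
    fix u v assume "u @ H # v \<in> GS n"
    then show "(u, v) \<in> (\<lambda>(p, i). (take i p, drop (Suc i) p)) ` (SIGMA p:GS n. {..<length p})"
      by (intro image_eqI[of _ _ "(u @ H # v, length u)"]) auto
  qed
qed (simp add: finite_GS)

text \<open>If the prefixes had different lengths, one entry of the longer prefix would have to
  equal both \<open>a\<close> and \<open>b\<close>. Hence the two paths of a covering pair together
  determine the marked position, which one path alone does not.\<close>

lemma append_eq_append_mark:
  assumes "u @ a # v = u' @ a # v'" "u @ b # w = u' @ b # w'" and "a \<noteq> b"
  shows "u = u' \<and> v = v'"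
proof -
  have "length u = length u'"
  proof (rule ccontr)
    assume "length u \<noteq> length u'"
    then consider "length u < length u'" | "length u' < length u" by linarith
    then show False
    proof cases
      case 1
      then show ?thesis
        using arg_cong[OF assms(1), of "\<lambda>p. p ! length u"] arg_cong[OF assms(2), of "\<lambda>p. p ! length u"]
        using \<open>a \<noteq> b\<close> by (simp add: nth_append)
    next
      case 2
      then show ?thesis
        using arg_cong[OF assms(1), of "\<lambda>p. p ! length u'"] arg_cong[OF assms(2), of "\<lambda>p. p ! length u'"]
        using \<open>a \<noteq> b\<close> by (simp add: nth_append)
    qed
  qed
  then show ?thesis using assms(1) by simp
qed

lemma ell_eq_sum_count: "ell n = 2 * (\<Sum>p\<in>GS n. count (mset p) H)"
proof -
  let ?E = "{(u, v). u @ H # v \<in> GS n}"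
  define f where "f = (\<lambda>(u, v). (u @ H # v, u @ U # D # v))"
  define g where "g = (\<lambda>(u, v). (u @ D # U # v, u @ H # v))"
  \<comment> \<open>Both \<open>D U\<close> and \<open>H\<close> have length two and total rise
    zero. So a marked \<open>H\<close> serves twice: as the lower end of a move to
    \<open>U D\<close> and as the upper end of a move from \<open>D U\<close>.\<close>
  have GS_iff: "u @ D # U # v \<in> GS n \<longleftrightarrow> u @ H # v \<in> GS n" for u v
    by (simp add: GS_def)
  have "GS_covers n = f ` ?E \<union> g ` ?E"
    unfolding GS_covers_eq_raises raises_def f_def g_def using GS_iff by auto
  \<comment> \<open>The two kinds of move are told apart by the number of steps, which grows by one
    under \<open>f\<close> and drops by one under \<open>g\<close>.\<close>
  moreover have "f ` ?E \<inter> g ` ?E = {}"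
  proof -
    have "length p < length q" if "(p, q) \<in> f ` ?E" for p q
      using that by (auto simp: f_def)
    moreover have "length p > length q" if "(p, q) \<in> g ` ?E" for p q
      using that by (auto simp: g_def)
    ultimately show ?thesis by fastforce
  qed
  moreover have "inj_on f ?E"
    by (rule inj_onI) (auto simp: f_def dest: append_eq_append_mark)
  moreover have "inj_on g ?E"
    by (rule inj_onI) (auto simp: g_def dest: append_eq_append_mark)
  ultimately have "ell n = card ?E + card ?E"
    unfolding ell_def using finite_marked_H by (simp add: card_Un_disjoint card_image)
  then show ?thesis by (simp add: card_marked_H)
qed

section \<open>Paths grouped by their number of up steps\<close>

definition step_mset :: "nat \<Rightarrow> nat \<Rightarrow> step multiset" where
  "step_mset n k = replicate_mset k U + replicate_mset k D + replicate_mset (n - k) H"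

lemma count_step_mset [simp]:
  "count (step_mset n k) U = k" "count (step_mset n k) D = k" "count (step_mset n k) H = n - k"
  by (simp_all add: step_mset_def)

lemma path_len_conv_count:
  "path_len p = count (mset p) U + count (mset p) D + 2 * count (mset p) H"
proof (induction p)
  case (Cons s p)
  then show ?case by (cases s) auto
qed simp

lemma path_end_conv_count: "path_end p = int (count (mset p) U) - int (count (mset p) D)"
proof (induction p)
  case (Cons s p)
  then show ?case by (cases s) auto
qed simp

lemma GS_eq_UN_permutations: "GS n = (\<Union>k\<le>n. permutations_of_multiset (step_mset n k))"
proof (intro set_eqI iffI)
  fix p assume "p \<in> GS n"
  then have *: "count (mset p) D = count (mset p) U" "count (mset p) U + count (mset p) H = n"
    by (auto simp: GS_def path_len_conv_count path_end_conv_count)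
  have "mset p = step_mset n (count (mset p) U)"
  proof (rule multiset_eqI)
    fix s show "count (mset p) s = count (step_mset n (count (mset p) U)) s"
      using * by (cases s) auto
  qed
  then show "p \<in> (\<Union>k\<le>n. permutations_of_multiset (step_mset n k))"
    using * by (auto simp: permutations_of_multiset_def intro!: bexI[of _ "count (mset p) U"])
next
  fix p assume "p \<in> (\<Union>k\<le>n. permutations_of_multiset (step_mset n k))"
  then show "p \<in> GS n"
    by (auto simp: GS_def path_len_conv_count path_end_conv_count permutations_of_multiset_def)
qed

lemma card_permutations_step_mset:
  assumes "k \<le> n"
  shows "card (permutations_of_multiset (step_mset n k)) = ((n + k) choose (2 * k)) * ((2 * k) choose k)"
proof -
  let ?M = "step_mset n k"
  \<comment> \<open>For \<open>k = 0\<close> or \<open>k = n\<close> some kinds of step are absent;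
    they contribute the factor \<open>fact 0 = 1\<close>.\<close>
  have "(\<Prod>s\<in>set_mset ?M. fact (count ?M s) :: nat) = (\<Prod>s\<in>UNIV. fact (count ?M s))"
    by (rule prod.mono_neutral_left) (auto simp: UNIV_step not_in_iff, metis step.exhaust)
  also have "\<dots> = fact k * fact k * fact (n - k)"
    unfolding UNIV_step by simp
  finally have prod: "(\<Prod>s\<in>set_mset ?M. fact (count ?M s) :: nat) = fact k * fact k * fact (n - k)" .
  have "size ?M = n + k"
    using assms by (simp add: step_mset_def)
  then have "card (permutations_of_multiset ?M) * (fact k * fact k * fact (n - k)) = fact (n + k)"
    using card_permutations_of_multiset_aux[of ?M] prod by simp
  also have "fact (n + k) = fact (2 * k) * fact (n - k) * ((n + k) choose (2 * k))"
    using binomial_fact_lemma[of "2 * k" "n + k"] assms by simp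
  also have "fact (2 * k) = fact k * fact k * ((2 * k) choose k)"
    using binomial_fact_lemma[of k "2 * k"] by simp
  finally have "(fact k * fact k * fact (n - k)) * card (permutations_of_multiset ?M) =
      (fact k * fact k * fact (n - k)) * (((n + k) choose (2 * k)) * ((2 * k) choose k))"
    by (simp only: mult_ac)
  then show ?thesis by (simp only: mult_cancel1) simp
qed

lemma sum_GS:
  "(\<Sum>p\<in>GS n. f (mset p)) =
    (\<Sum>k\<le>n. ((n + k) choose (2 * k)) * ((2 * k) choose k) * f (step_mset n k))"
proof -
  have "(\<Sum>p\<in>GS n. f (mset p)) =
      (\<Sum>k\<le>n. \<Sum>p\<in>permutations_of_multiset (step_mset n k). f (mset p))"
    unfolding GS_eq_UN_permutations
  proof (rule sum.UNION_disjoint)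
    show "\<forall>i\<in>{..n}. \<forall>j\<in>{..n}. i \<noteq> j \<longrightarrow>
        permutations_of_multiset (step_mset n i) \<inter> permutations_of_multiset (step_mset n j) = {}"
      by (auto simp: permutations_of_multiset_def) (metis count_step_mset(1))
  qed auto
  also have "\<dots> = (\<Sum>k\<le>n. card (permutations_of_multiset (step_mset n k)) * f (step_mset n k))"
    by (intro sum.cong) (auto simp: permutations_of_multiset_def)
  finally show ?thesis by (simp add: card_permutations_step_mset)
qed

lemma card_GS: "card (GS n) = (\<Sum>k\<le>n. ((n + k) choose (2 * k)) * ((2 * k) choose k))"
  using sum_GS[where f = "\<lambda>_. 1"] by simp

lemma ell_eq: "ell n = 2 * (\<Sum>k\<le>n. ((n + k) choose (2 * k)) * ((2 * k) choose k) * (n - k))"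
  using sum_GS[of "\<lambda>M. count M H"] by (simp add: ell_eq_sum_count)

section \<open>Power series of negative half-integer powers\<close>

text \<open>The coefficients of \<open>(1 - 4 y) powr (-3/2)\<close>.\<close>
definition central_coeff :: "nat \<Rightarrow> nat" where
  "central_coeff k = (2 * k + 1) * ((2 * k) choose k)"

lemma central_coeff_pos: "central_coeff k > 0"
  by (simp add: central_coeff_def)

lemma central_coeff_fact: "real (central_coeff k) = fact (2 * k + 1) / (fact k)\<^sup>2"
  by (simp add: central_coeff_def binomial_fact power2_eq_square field_simps)

lemma central_coeff_Suc: "real (central_coeff (Suc k)) = real (central_coeff k) * (2 * (2 * real k + 3) / (real k + 1))"
  by (simp add: central_coeff_fact power2_eq_square divide_simps) (simp add: algebra_simps)

lemma central_coeff_gbinomial: "real (central_coeff k) = (-3/2 gchoose k) * (-4) ^ k"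
proof (induction k)
  case 0
  then show ?case by (simp add: central_coeff_def)
next
  case (Suc k)
  have eq: "(-3/2 gchoose Suc k :: real) = (-3/2 gchoose k) * ((-3/2 - real k) / (real k + 1))"
    by (simp add: gbinomial_prod_rev field_simps)
  show ?case
    unfolding central_coeff_Suc Suc.IH power_Suc eq by (simp add: divide_simps) (simp add: algebra_simps)
qed

lemma central_coeff_sums:
  fixes y :: real
  assumes "\<bar>y\<bar> < 1/4"
  shows "(\<lambda>k. real (central_coeff k) * y ^ k) sums (1 - 4 * y) powr (-3/2)"
  using gen_binomial_real[of "-4 * y" "-3/2"] assms
  by (simp add: central_coeff_gbinomial mult.assoc flip: power_mult_distrib)

text \<open>Unconditional convergence is what permits the rearrangement of a double series
  below.\<close>

lemma central_coeff_has_sum: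
  fixes y :: real
  assumes "\<bar>y\<bar> < 1/4"
  shows "((\<lambda>k. real (central_coeff k) * y ^ k) has_sum (1 - 4 * y) powr (-3/2)) UNIV"
proof (rule norm_summable_imp_has_sum)
  show "summable (\<lambda>k. norm (real (central_coeff k) * y ^ k))"
    using central_coeff_sums[of "\<bar>y\<bar>"] assms by (auto simp: abs_mult power_abs dest: sums_summable)
qed (rule central_coeff_sums[OF assms])

lemma binomial_series_neg_sums:
  fixes z :: real
  assumes "\<bar>z\<bar> < 1"
  shows "(\<lambda>m. real ((m + s) choose s) * z ^ m) sums (1 / (1 - z) ^ (s + 1))"
proof -
  have "(- real (s + 1) gchoose m) * (- z) ^ m = real ((m + s) choose s) * z ^ m" for m
  proof -
    have "(- real (s + 1) gchoose m) = (-1) ^ m * (real (s + m) gchoose m)"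
      using gbinomial_minus[of "real (s + 1)" m] by (simp add: algebra_simps)
    also have "(real (s + m) gchoose m) = real ((m + s) choose s)"
      using binomial_symmetric[of m "s + m"] by (simp only: binomial_gbinomial[symmetric]) (simp add: add.commute)
    finally have "(- real (s + 1) gchoose m) * (- z) ^ m
        = real ((m + s) choose s) * ((-1) ^ m * (- z) ^ m)"
      by (simp only: mult_ac)
    then show ?thesis by (simp flip: power_mult_distrib)
  qed
  moreover have "(1 + - z) powr - real (s + 1) = 1 / (1 - z) ^ (s + 1)"
    using assms by (subst powr_minus_divide, subst powr_realpow) auto
  ultimately show ?thesis
    using gen_binomial_real[of "-z" "- real (s + 1)"] assms by simp
qed

lemma binomial_series_neg_has_sum:
  fixes z :: real
  assumes "\<bar>z\<bar> < 1"
  shows "((\<lambda>m. real ((m + s) choose s) * z ^ m) has_sum (1 / (1 - z) ^ (s + 1))) UNIV"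
proof (rule norm_summable_imp_has_sum)
  show "summable (\<lambda>m. norm (real ((m + s) choose s) * z ^ m))"
    using binomial_series_neg_sums[of "\<bar>z\<bar>" s] assms
    by (auto simp: abs_mult power_abs dest: sums_summable)
qed (rule binomial_series_neg_sums[OF assms])

text \<open>With y = b x^r / (1 - a x)^2 the function is (1 - a x)^(-3) (1 - 4 y)^(-3/2). Expanding
  in y leaves the powers (1 - a x)^(-(2 k + 3)), which are binomial series, and the terms are then
  collected by the degree n = r k + m. The choices (a, b, r) = (1, 1, 1) and (3, 2, 2) produce the
  same quadratic, hence two formulas for the same coefficients.\<close>

lemma quadratic_powr_sums:
  fixes a b x :: real and r :: nat
  assumes "0 \<le> a" "0 \<le> b" "0 < r" and ax: "a * \<bar>x\<bar> < 1" and bx: "4 * b * \<bar>x\<bar> ^ r < (1 - a * \<bar>x\<bar>)\<^sup>2"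
  shows "(\<lambda>n. (\<Sum>k\<le>n div r. real (central_coeff k) * b ^ k * real ((n - r * k + 2 * k + 2) choose (2 * k + 2)) * a ^ (n - r * k)) * x ^ n)
    sums ((1 - a * x)\<^sup>2 - 4 * b * x ^ r) powr (-3/2)"
proof -
  define f where "f = (\<lambda>x (k, m). real (central_coeff k) * b ^ k * real ((m + (2 * k + 2)) choose (2 * k + 2)) * a ^ m * x ^ (r * k + m))"
  define g where "g = (\<lambda>x k. real (central_coeff k) * (b * x ^ r / (1 - a * x)\<^sup>2) ^ k * (1 / (1 - a * x) ^ 3))"
  have inner: "((\<lambda>m. f x (k, m)) has_sum g x k) UNIV" if "a * \<bar>x\<bar> < 1" for x k
  proof -
    have "\<bar>a * x\<bar> < 1" using that \<open>0 \<le> a\<close> by (simp add: abs_mult)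
    note has_sum_cmult_right[OF binomial_series_neg_has_sum[OF this, of "2 * k + 2"], of "real (central_coeff k) * (b * x ^ r) ^ k"]
    moreover have "f x (k, m) = real (central_coeff k) * (b * x ^ r) ^ k
        * (real ((m + (2 * k + 2)) choose (2 * k + 2)) * (a * x) ^ m)" for m
      unfolding f_def prod.case power_mult_distrib power_add[of x] power_mult[of x]
      by (simp only: mult_ac)
    moreover have "g x k = real (central_coeff k) * (b * x ^ r) ^ k * (1 / (1 - a * x) ^ (2 * k + 2 + 1))"
      by (simp add: g_def power_divide power_add power_mult_distrib eval_nat_numeral)
    ultimately show ?thesis by simp
  qed
  have outer: "(g x has_sum ((1 - a * x)\<^sup>2 - 4 * b * x ^ r) powr (-3/2)) UNIV"
    if ax: "a * \<bar>x\<bar> < 1" and bx: "4 * b * \<bar>x\<bar> ^ r < (1 - a * \<bar>x\<bar>)\<^sup>2" for x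
  proof -
    let ?y = "b * x ^ r / (1 - a * x)\<^sup>2"
    have le: "1 - a * \<bar>x\<bar> \<le> 1 - a * x"
      using \<open>0 \<le> a\<close> by (simp add: mult_left_mono)
    then have pos: "0 < 1 - a * x" using ax by linarith
    have "\<bar>b * x ^ r\<bar> * 4 < (1 - a * \<bar>x\<bar>)\<^sup>2"
      using bx \<open>0 \<le> b\<close> by (simp add: abs_mult power_abs mult_ac)
    also have "\<dots> \<le> (1 - a * x)\<^sup>2"
      using le ax by (intro power_mono) auto
    finally have y: "\<bar>?y\<bar> < 1/4"
      using pos by (simp add: divide_simps abs_mult)
    have "((1 - a * x)\<^sup>2 - 4 * b * x ^ r) powr (-3/2) = ((1 - a * x)\<^sup>2 * (1 - 4 * ?y)) powr (-3/2)"
      using pos by (simp add: right_diff_distrib mult.assoc)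
    also have "\<dots> = ((1 - a * x)\<^sup>2) powr (-3/2) * (1 - 4 * ?y) powr (-3/2)"
      by (rule powr_mult)
    also have "((1 - a * x)\<^sup>2) powr (-3/2) = ((1 - a * x) powr 2) powr (-3/2)"
      using pos by simp
    also have "\<dots> = 1 / (1 - a * x) ^ 3"
      using pos by (simp only: powr_powr) (simp add: powr_minus_divide)
    finally show ?thesis
      using has_sum_cmult_left[OF central_coeff_has_sum[OF y], of "1 / (1 - a * x) ^ 3"]
      by (simp add: g_def mult.commute)
  qed
  \<comment> \<open>At \<bar>x\<bar> all terms are nonnegative, so convergence of the iterated sums
    already gives summability; these terms are the absolute values of the terms at x. This is why
    the hypotheses are stated for \<bar>x\<bar>.\<close>
  have "f \<bar>x\<bar> summable_on (UNIV \<times> UNIV)"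
  proof (rule summable_on_SigmaI)
    show "((\<lambda>m. f \<bar>x\<bar> (k, m)) has_sum g \<bar>x\<bar> k) UNIV" for k
      by (rule inner) (use ax in simp)
    show "g \<bar>x\<bar> summable_on UNIV"
      using outer[of "\<bar>x\<bar>"] ax bx by (auto simp: summable_on_def)
    show "0 \<le> f \<bar>x\<bar> (k, m)" for k m
      using assms by (simp add: f_def)
  qed
  then have "(\<lambda>p. norm (f x p)) summable_on (UNIV \<times> UNIV)"
    by (rule summable_on_cong[THEN iffD1, rotated])
      (use assms in \<open>auto simp: f_def abs_mult power_abs\<close>)
  then have "f x summable_on (UNIV \<times> UNIV)"
    by (rule abs_summable_summable)
  then have "(f x has_sum ((1 - a * x)\<^sup>2 - 4 * b * x ^ r) powr (-3/2)) (UNIV \<times> UNIV)"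
    by (intro has_sum_SigmaI[OF inner outer]) (use ax bx in auto)
  also have "?this \<longleftrightarrow> ((\<lambda>(n, k). f x (k, n - r * k)) has_sum ((1 - a * x)\<^sup>2 - 4 * b * x ^ r) powr (-3/2))
      (SIGMA n:UNIV. {..n div r})"
    using \<open>0 < r\<close>
    by (intro has_sum_reindex_bij_witness[of _ "\<lambda>(n, k). (k, n - r * k)" "\<lambda>(k, m). (r * k + m, k)"])
      (auto simp: less_eq_div_iff_mult_less_eq mult.commute)
  finally have "((\<lambda>n. \<Sum>k\<le>n div r. f x (k, n - r * k)) has_sum ((1 - a * x)\<^sup>2 - 4 * b * x ^ r) powr (-3/2)) UNIV"
    by (rule has_sum_SigmaD) (auto intro: has_sum_finite)
  also have "(\<lambda>n. \<Sum>k\<le>n div r. f x (k, n - r * k)) =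
      (\<lambda>n. (\<Sum>k\<le>n div r. real (central_coeff k) * b ^ k * real ((n - r * k + 2 * k + 2) choose (2 * k + 2)) * a ^ (n - r * k)) * x ^ n)"
  proof
    fix n
    have "f x (k, n - r * k) =
        real (central_coeff k) * b ^ k * real ((n - r * k + 2 * k + 2) choose (2 * k + 2)) * a ^ (n - r * k) * x ^ n"
      if "k \<le> n div r" for k
    proof -
      have "r * k \<le> n" using that \<open>0 < r\<close> by (simp add: less_eq_div_iff_mult_less_eq mult.commute)
      then show ?thesis by (simp add: f_def add.assoc)
    qed
    then show "(\<Sum>k\<le>n div r. f x (k, n - r * k)) =
      (\<Sum>k\<le>n div r. real (central_coeff k) * b ^ k * real ((n - r * k + 2 * k + 2) choose (2 * k + 2)) * a ^ (n - r * k)) * x ^ n"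
      by (simp add: sum_distrib_right)
  qed
  finally show ?thesis by (rule has_sum_imp_sums)
qed

text \<open>Once the lower coefficients vanish, the series may be divided by \<open>x ^ n\<close>
  for nonzero x, and the limit at 0 isolates the next coefficient.\<close>

lemma powser_eq_0:
  fixes a :: "nat \<Rightarrow> real"
  assumes "0 < s" and sums: "\<And>x. \<bar>x\<bar> < s \<Longrightarrow> (\<lambda>n. a n * x ^ n) sums 0"
  shows "a n = 0"
proof (induction n rule: less_induct)
  case (less n)
  have "(\<lambda>k. a (k + n) * x ^ k) sums 0" if "x \<noteq> 0" "norm x < s" for x
  proof -
    have "(\<lambda>k. a (k + n) * x ^ (k + n)) sums 0"
      using sums_split_initial_segment[OF sums[of x], of n] that less by simp
    from sums_divide[OF this, of "x ^ n"] show ?thesis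
      using that by (simp add: power_add)
  qed
  from powser_limit_0_strong[OF \<open>0 < s\<close> this] have lim: "((\<lambda>_. 0) \<longlongrightarrow> a (0 + n)) (at (0::real))"
    by simp
  show ?case using tendsto_unique[OF _ lim tendsto_const] by simp
qed

lemma powser_unique:
  fixes a b :: "nat \<Rightarrow> real"
  assumes "0 < s" and "\<And>x. \<bar>x\<bar> < s \<Longrightarrow> (\<lambda>n. a n * x ^ n) sums f x"
    and "\<And>x. \<bar>x\<bar> < s \<Longrightarrow> (\<lambda>n. b n * x ^ n) sums f x"
  shows "a n = b n"
proof -
  have "(\<lambda>n. (a n - b n) * x ^ n) sums 0" if "\<bar>x\<bar> < s" for x
    using sums_diff[OF assms(2,3)[OF that]] by (simp add: left_diff_distrib)
  from powser_eq_0[OF \<open>0 < s\<close> this] show ?thesis by simp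
qed

section \<open>Generating function and the two closed forms\<close>

text \<open>The coefficient of \<open>x ^ (n - 1)\<close> in \<open>(1 - 6 * x + x\<^sup>2) powr (-3/2)\<close>; the shift by one makes the
  recurrence for \<open>ell\<close> hold from \<open>n = 0\<close> on.\<close>
definition quad_coeff :: "nat \<Rightarrow> nat" where
  "quad_coeff n = (\<Sum>k<n. central_coeff k * ((n + k + 1) choose (2 * k + 2)))"

lemma quad_coeff_0 [simp]: "quad_coeff 0 = 0"
  by (simp add: quad_coeff_def)

lemma binomial_mult_diff: "(n choose k) * (n - k) = Suc k * (n choose Suc k)"
  using binomial_absorb_comp[of n k] binomial_absorption[of k n] by (simp add: mult.commute)

lemma ell_Suc: "ell (Suc n) + 2 * quad_coeff n = 2 * quad_coeff (Suc n)"
proof -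
  \<comment> \<open>The top term \<open>k = Suc n\<close> carries the factor zero and is
    dropped.\<close>
  have "ell (Suc n) = 2 * (\<Sum>k\<le>n. ((Suc n + k) choose (2 * k)) * ((2 * k) choose k) * (Suc n - k))"
    by (simp add: ell_eq)
  also have "\<dots> = 2 * (\<Sum>k\<le>n. central_coeff k * ((n + k + 1) choose (2 * k + 1)))"
  proof (intro arg_cong[of _ _ "(*) 2"] sum.cong refl)
    fix k
    \<comment> \<open>The absorption identity trades the weight \<open>Suc n - k\<close> for
      \<open>2 * k + 1\<close>, the factor that turns the central binomial coefficient into
      \<open>central_coeff k\<close>.\<close>
    have *: "((Suc n + k) choose (2 * k)) * (Suc n - k) = (2 * k + 1) * ((n + k + 1) choose (2 * k + 1))"
      using binomial_mult_diff[of "Suc n + k" "2 * k"] by (simp del: binomial_Suc_Suc)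
    have "((Suc n + k) choose (2 * k)) * ((2 * k) choose k) * (Suc n - k)
        = ((2 * k) choose k) * (((Suc n + k) choose (2 * k)) * (Suc n - k))"
      by (simp only: mult_ac)
    also have "\<dots> = central_coeff k * ((n + k + 1) choose (2 * k + 1))"
      unfolding * central_coeff_def by (simp only: mult_ac)
    finally show "((Suc n + k) choose (2 * k)) * ((2 * k) choose k) * (Suc n - k)
        = central_coeff k * ((n + k + 1) choose (2 * k + 1))" .
  qed
  finally have "ell (Suc n) = 2 * (\<Sum>k\<le>n. central_coeff k * ((n + k + 1) choose (2 * k + 1)))" .
  \<comment> \<open>The added term \<open>k = n\<close> is zero since
    \<open>2 * n + 1 < 2 * n + 2\<close>; it gives all three sums the same range.\<close>
  moreover have "quad_coeff n = (\<Sum>k\<le>n. central_coeff k * ((n + k + 1) choose (2 * k + 2)))"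
    by (simp add: quad_coeff_def flip: lessThan_Suc_atMost)
  moreover have "quad_coeff (Suc n) = (\<Sum>k\<le>n. central_coeff k * ((n + k + 1) choose (2 * k + 1)) + central_coeff k * ((n + k + 1) choose (2 * k + 2)))"
    unfolding quad_coeff_def lessThan_Suc_atMost
  proof (rule sum.cong[OF refl])
    fix k
    have "(Suc n + k + 1) choose (2 * k + 2) = ((n + k + 1) choose (2 * k + 1)) + ((n + k + 1) choose (2 * k + 2))"
      using binomial_Suc_Suc[of "n + k + 1" "2 * k + 1"] by (simp del: binomial_Suc_Suc)
    then show "central_coeff k * ((Suc n + k + 1) choose (2 * k + 2))
        = central_coeff k * ((n + k + 1) choose (2 * k + 1)) + central_coeff k * ((n + k + 1) choose (2 * k + 2))"
      by (simp only: distrib_left)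
  qed
  ultimately show ?thesis
    by (simp only: sum.distrib distrib_left)
qed

text \<open>Each path in \<open>GS n\<close> has exactly n steps that are \<open>U\<close> or
  \<open>H\<close>. Over all paths the \<open>H\<close> steps number half of \<open>ell n\<close>,
  and the \<open>U\<close> steps number \<open>2 * quad_coeff n\<close>.\<close>

lemma mult_card_GS: "2 * n * card (GS n) = ell n + 4 * quad_coeff n"
proof -
  let ?t = "\<lambda>k. ((n + k) choose (2 * k)) * ((2 * k) choose k)"
  have "(\<Sum>k\<le>n. ?t k * k) = (\<Sum>k<n. ?t (Suc k) * Suc k)"
    by (simp add: sum.atMost_shift)
  also have "\<dots> = (\<Sum>k<n. 2 * (central_coeff k * ((n + k + 1) choose (2 * k + 2))))"
  proof (rule sum.cong[OF refl])
    fix k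
    have *: "real ((2 * Suc k) choose Suc k) = fact (2 * Suc k) / (fact (Suc k) * fact (Suc k))"
      using binomial_fact[of "Suc k" "2 * Suc k", where 'a = real] by simp
    have "real (((2 * Suc k) choose Suc k) * Suc k) = real (2 * central_coeff k)"
      unfolding of_nat_mult * central_coeff_fact by (simp add: power2_eq_square divide_simps)
    then have **: "((2 * Suc k) choose Suc k) * Suc k = 2 * central_coeff k"
      by (simp only: of_nat_eq_iff)
    show "?t (Suc k) * Suc k = 2 * (central_coeff k * ((n + k + 1) choose (2 * k + 2)))"
      unfolding mult.assoc ** by (simp del: binomial_Suc_Suc)
  qed
  also have "\<dots> = 2 * quad_coeff n"
    by (simp add: quad_coeff_def sum_distrib_left)
  finally have *: "(\<Sum>k\<le>n. ?t k * k) = 2 * quad_coeff n" .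
  have "n * card (GS n) = (\<Sum>k\<le>n. ?t k * (n - k) + ?t k * k)"
    unfolding card_GS sum_distrib_left
    by (intro sum.cong refl) (simp flip: distrib_left)
  also have "\<dots> = (\<Sum>k\<le>n. ?t k * (n - k)) + 2 * quad_coeff n"
    by (simp add: sum.distrib *)
  finally show ?thesis by (simp add: ell_eq)
qed

lemma quadratic_pos:
  fixes t :: real
  assumes "t < 3 - 2 * sqrt 2"
  shows "0 < 1 - 6 * t + t\<^sup>2"
proof -
  have "0 < (3 - 2 * sqrt 2 - t) * (3 + 2 * sqrt 2 - t)"
  proof (rule mult_pos_pos)
    have "0 \<le> sqrt (2::real)" by simp
    then show "0 < 3 + 2 * sqrt 2 - t" using assms by linarith
  qed (use assms in simp)
  also have "\<dots> = 1 - 6 * t + t\<^sup>2"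
    by (simp add: algebra_simps power2_eq_square)
  finally show ?thesis .
qed

text \<open>The bound 1/3 keeps \<open>1 - 3 * x\<close> positive on the whole disc of convergence,
  as the second expansion requires.\<close>

lemma radius_bounds: "0 < 3 - 2 * sqrt 2" "3 - 2 * sqrt 2 < 1/3"
proof -
  have "sqrt 2 < 3/2" by (rule real_less_lsqrt) (auto simp: power2_eq_square)
  then show "0 < 3 - 2 * sqrt 2" by simp
  have "sqrt 2 > 4/3" by (rule real_less_rsqrt) (auto simp: power2_eq_square)
  then show "3 - 2 * sqrt 2 < 1/3" by simp
qed

lemma quad_coeff_Suc_sums:
  fixes x :: real
  assumes "\<bar>x\<bar> < 3 - 2 * sqrt 2"
  shows "(\<lambda>n. real (quad_coeff (Suc n)) * x ^ n) sums (1 - 6 * x + x\<^sup>2) powr (-3/2)"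
proof -
  have Q: "(1 - x)\<^sup>2 - 4 * x = 1 - 6 * x + x\<^sup>2"
    by (simp add: power2_eq_square algebra_simps)
  have "(\<lambda>n. (\<Sum>k\<le>n div 1. real (central_coeff k) * 1 ^ k * real ((n - 1 * k + 2 * k + 2) choose (2 * k + 2)) * 1 ^ (n - 1 * k)) * x ^ n)
    sums ((1 - 1 * x)\<^sup>2 - 4 * 1 * x ^ 1) powr (-3/2)"
    by (rule quadratic_powr_sums)
      (use quadratic_pos[OF assms] radius_bounds assms in \<open>auto simp: power2_eq_square algebra_simps\<close>)
  moreover have "(\<Sum>k\<le>n div 1. real (central_coeff k) * 1 ^ k * real ((n - 1 * k + 2 * k + 2) choose (2 * k + 2)) * 1 ^ (n - 1 * k))
      = real (quad_coeff (Suc n))" for n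
    unfolding quad_coeff_def lessThan_Suc_atMost of_nat_sum
  proof (rule sum.cong)
    fix k assume "k \<in> {..n}"
    then have "n - 1 * k + 2 * k + 2 = Suc n + k + 1" by simp
    then show "real (central_coeff k) * 1 ^ k * real ((n - 1 * k + 2 * k + 2) choose (2 * k + 2)) * 1 ^ (n - 1 * k)
        = real (central_coeff k * ((Suc n + k + 1) choose (2 * k + 2)))"
      by (simp only: of_nat_mult power_one mult_1_right)
  qed simp
  ultimately show ?thesis by (simp add: Q)
qed

lemma quad_coeff_Suc_eq:
  "real (quad_coeff (Suc n)) = (\<Sum>k\<le>n div 2. real (central_coeff k) * 2 ^ k * real ((n + 2) choose (2 * k + 2)) * 3 ^ (n - 2 * k))"
proof -
  define b where "b = (\<lambda>n. \<Sum>k\<le>n div 2. real (central_coeff k) * 2 ^ k *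
      real ((n - 2 * k + 2 * k + 2) choose (2 * k + 2)) * 3 ^ (n - 2 * k))"
  have b_sums: "(\<lambda>n. b n * x ^ n) sums (1 - 6 * x + x\<^sup>2) powr (-3/2)" if x: "\<bar>x\<bar> < 3 - 2 * sqrt 2" for x
  proof -
    have "(\<lambda>n. b n * x ^ n) sums ((1 - 3 * x)\<^sup>2 - 4 * 2 * x ^ 2) powr (-3/2)"
      unfolding b_def
      by (rule quadratic_powr_sums)
        (use quadratic_pos[OF x] radius_bounds x in \<open>auto simp: power2_eq_square algebra_simps\<close>)
    moreover have "(1 - 3 * x)\<^sup>2 - 4 * 2 * x ^ 2 = 1 - 6 * x + x\<^sup>2"
      by (simp add: power2_eq_square algebra_simps)
    ultimately show ?thesis by (simp only:)
  qed
  have "real (quad_coeff (Suc n)) = b n"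
    by (rule powser_unique[OF radius_bounds(1), where f = "\<lambda>x. (1 - 6 * x + x\<^sup>2) powr (-3/2)"])
      (rule quad_coeff_Suc_sums b_sums, assumption)+
  also have "b n = (\<Sum>k\<le>n div 2. real (central_coeff k) * 2 ^ k * real ((n + 2) choose (2 * k + 2)) * 3 ^ (n - 2 * k))"
    unfolding b_def
  proof (rule sum.cong)
    fix k assume "k \<in> {..n div 2}"
    then have "n - 2 * k + 2 * k + 2 = n + 2" by auto
    then show "real (central_coeff k) * 2 ^ k * real ((n - 2 * k + 2 * k + 2) choose (2 * k + 2)) * 3 ^ (n - 2 * k)
        = real (central_coeff k) * 2 ^ k * real ((n + 2) choose (2 * k + 2)) * 3 ^ (n - 2 * k)"
      by (simp only:)
  qed simp
  finally show ?thesis .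
qed

lemma ell_sums:
  fixes x :: real
  assumes "\<bar>x\<bar> < 3 - 2 * sqrt 2"
  shows "(\<lambda>n. real (ell n) * x ^ n) sums (2 * (x - x\<^sup>2) / (1 - 6 * x + x\<^sup>2) powr (3/2))"
proof -
  define S where "S = (1 - 6 * x + x\<^sup>2) powr (-3/2)"
  have "(\<lambda>n. x * (real (quad_coeff (Suc n)) * x ^ n)) sums (x * S)"
    unfolding S_def by (intro sums_mult quad_coeff_Suc_sums[OF assms])
  then have s1: "(\<lambda>n. real (quad_coeff (Suc n)) * x ^ Suc n) sums (x * S)"
    by (simp only: power_Suc mult_ac)
  then have "(\<lambda>n. real (quad_coeff n) * x ^ n) sums (x * S)"
    using sums_Suc_iff[of "\<lambda>n. real (quad_coeff n) * x ^ n"] by simp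
  from sums_mult[OF this, of x] have s0: "(\<lambda>n. real (quad_coeff n) * x ^ Suc n) sums (x * (x * S))"
    by (simp only: power_Suc mult_ac)
  have ell: "real (ell (Suc n)) = 2 * (real (quad_coeff (Suc n)) - real (quad_coeff n))" for n
    using arg_cong[OF ell_Suc[of n], of real] by simp
  have "(\<lambda>n. 2 * (real (quad_coeff (Suc n)) * x ^ Suc n - real (quad_coeff n) * x ^ Suc n)) sums (2 * (x * S - x * (x * S)))"
    by (intro sums_mult sums_diff s1 s0)
  then have "(\<lambda>n. real (ell (Suc n)) * x ^ Suc n) sums (2 * (x * S - x * (x * S)))"
    by (simp only: ell mult.assoc flip: left_diff_distrib)
  then have "(\<lambda>n. real (ell n) * x ^ n) sums (2 * (x * S - x * (x * S)))"
    using sums_Suc_iff[of "\<lambda>n. real (ell n) * x ^ n"] by (simp add: ell_eq)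
  also have "2 * (x * S - x * (x * S)) = 2 * (x - x\<^sup>2) / (1 - 6 * x + x\<^sup>2) powr (3/2)"
  proof -
    have "S = 1 / (1 - 6 * x + x\<^sup>2) powr (3/2)"
      unfolding S_def by (simp add: powr_minus_divide)
    then show ?thesis by (simp add: power2_eq_square left_diff_distrib diff_divide_distrib)
  qed
  finally show ?thesis .
qed

text \<open>A common range \<open>K\<close> lets the sums for n and n - 1 be subtracted term by
  term. The extra terms vanish through their binomial coefficients, but their exponent of 3 may be
  negative, hence the integer power.\<close>

lemma quad_coeff_eq_powi:
  assumes "n div 2 \<le> K"
  shows "real (quad_coeff n) = (\<Sum>k\<le>K. real (central_coeff k) * 2 ^ k * real ((n + 1) choose (2 * k + 2)) * 3 powi (int n - 1 - 2 * int k))"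
proof (cases n)
  case 0
  then show ?thesis by (simp add: binomial_eq_0)
next
  case (Suc m)
  have "real (quad_coeff n) = (\<Sum>k\<le>m div 2. real (central_coeff k) * 2 ^ k * real ((n + 1) choose (2 * k + 2)) * 3 powi (int n - 1 - 2 * int k))"
    unfolding Suc quad_coeff_Suc_eq
  proof (rule sum.cong)
    fix k assume "k \<in> {..m div 2}"
    then have "int (Suc m) - 1 - 2 * int k = int (m - 2 * k)" by auto
    then have "(3::real) powi (int (Suc m) - 1 - 2 * int k) = 3 ^ (m - 2 * k)"
      by (simp only: power_int_of_nat)
    moreover have "m + 2 = Suc m + 1" by simp
    ultimately show "real (central_coeff k) * 2 ^ k * real ((m + 2) choose (2 * k + 2)) * 3 ^ (m - 2 * k)
        = real (central_coeff k) * 2 ^ k * real ((Suc m + 1) choose (2 * k + 2)) * 3 powi (int (Suc m) - 1 - 2 * int k)"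
      by (simp only:)
  qed simp
  also have "\<dots> = (\<Sum>k\<le>K. real (central_coeff k) * 2 ^ k * real ((n + 1) choose (2 * k + 2)) * 3 powi (int n - 1 - 2 * int k))"
  proof (rule sum.mono_neutral_left)
    have "m div 2 \<le> n div 2" using Suc by (simp add: div_le_mono)
    then show "{..m div 2} \<subseteq> {..K}" using assms by auto
    show "\<forall>k\<in>{..K} - {..m div 2}. real (central_coeff k) * 2 ^ k * real ((n + 1) choose (2 * k + 2)) * 3 powi (int n - 1 - 2 * int k) = 0"
    proof
      fix k assume "k \<in> {..K} - {..m div 2}"
      then have "n + 1 < 2 * k + 2" using Suc by auto
      then have "(n + 1) choose (2 * k + 2) = 0" by (rule binomial_eq_0)
      then show "real (central_coeff k) * 2 ^ k * real ((n + 1) choose (2 * k + 2)) * 3 powi (int n - 1 - 2 * int k) = 0"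
        by (simp only:)
    qed
  qed simp
  finally show ?thesis .
qed

text \<open>Here m stands for n - 1 - 2 k. The factor 3 is the additional power of 3 that the
  formula for \<open>quad_coeff n\<close> carries over that for
  \<open>quad_coeff (n - 1)\<close>.\<close>

lemma trinomial_term_eq:
  fixes k m :: nat
  shows "2 * (real (central_coeff k) * real ((2 * k + m + 2) choose (2 * k + 2)) * 3 - real (central_coeff k) * real ((2 * k + m + 1) choose (2 * k + 2)))
    = real ((2 * k + m + 1) choose k) * real ((k + m + 1) choose k) * (real (m + 1) * real (3 * k + m + 3) / real (k + 1)) * 2"
proof -
  define F where "F = (fact (2 * k + m + 1) :: real)"
  have F0: "F > 0" by (simp add: F_def)
  have 1: "real ((2 * k + m + 2) choose (2 * k + 2)) = real (2 * k + m + 2) * F / (real (2 * k + 2) * fact (2 * k + 1) * fact m)"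
    using binomial_fact[of "2 * k + 2" "2 * k + m + 2", where 'a = real] by (simp add: F_def field_simps)
  have 2: "real ((2 * k + m + 1) choose (2 * k + 2)) = real m * F / (real (2 * k + 2) * fact (2 * k + 1) * fact m)"
  proof -
    have "m * ((2 * k + m + 2) choose (2 * k + 2)) = (2 * k + m + 2) * ((2 * k + m + 1) choose (2 * k + 2))"
      using binomial_absorb_comp[of "2 * k + m + 2" "2 * k + 2"] by (simp del: binomial_Suc_Suc)
    from arg_cong[OF this, of real] show ?thesis
      unfolding of_nat_mult 1 by (simp add: field_simps del: binomial_Suc_Suc fact_Suc of_nat_Suc)
  qed
  have 3: "real ((2 * k + m + 1) choose k) * real ((k + m + 1) choose k) = F / ((fact k)\<^sup>2 * real (m + 1) * fact m)"
  proof -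
    have "real ((2 * k + m + 1) choose k) = F / (fact k * fact (k + m + 1))"
      using binomial_fact[of k "2 * k + m + 1", where 'a = real] by (simp add: F_def)
    moreover have "real ((k + m + 1) choose k) = fact (k + m + 1) / (fact k * ((m + 1) * fact m))"
      using binomial_fact[of k "k + m + 1", where 'a = real] by simp (simp add: algebra_simps)
    ultimately show ?thesis by (simp add: power2_eq_square del: fact_Suc) (simp add: algebra_simps)
  qed
  \<comment> \<open>With x = k + 1 and y = m + 1 the content is 3 (2 x + y - 1) - (y - 1) = 2 (3 x +
    y - 1), and 3 x + y - 1 is the factor n + k + 2 of the closed form.\<close>
  have alg: "2 * (G / f * ((2 * x + y - 1) * F / (2 * x * G * M)) * 3 - G / f * ((y - 1) * F / (2 * x * G * M)))
      = F / (f * y * M) * (y * (3 * x + y - 1) / x) * 2"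
    if "G > 0" "f > 0" "M > 0" "x > 0" "y > 0" for G f M x y :: real
    using that by (simp add: divide_simps) (simp add: algebra_simps)
  have cast: "real (2 * k + m + 2) = 2 * real (k + 1) + real (m + 1) - 1" "real m = real (m + 1) - 1"
    "real (2 * k + 2) = 2 * real (k + 1)" "real (3 * k + m + 3) = 3 * real (k + 1) + real (m + 1) - 1"
    by simp_all
  have "2 * (real (central_coeff k) * real ((2 * k + m + 2) choose (2 * k + 2)) * 3 - real (central_coeff k) * real ((2 * k + m + 1) choose (2 * k + 2)))
    = F / ((fact k)\<^sup>2 * real (m + 1) * fact m) * (real (m + 1) * real (3 * k + m + 3) / real (k + 1)) * 2"
    unfolding 1 2 central_coeff_fact cast by (rule alg) simp_all
  then show ?thesis unfolding 3 .
qed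

lemma ell_eq_trinomial_sum:
  "real (ell n) = (\<Sum>k = 0..n div 2. real (n choose k) * real ((n - k) choose k)
              * (real (n - 2 * k) * real (n + k + 2) / real (k + 1))
              * 2 ^ (k + 1) * (3::real) powi (int n - 2 * int k - 2))"
proof (cases n)
  case 0
  then show ?thesis by (simp add: ell_eq)
next
  case (Suc n')
  let ?T = "\<lambda>n k. real (central_coeff k) * 2 ^ k * real ((n + 1) choose (2 * k + 2)) * 3 powi (int n - 1 - 2 * int k)"
  have "real (ell n) = 2 * (real (quad_coeff n) - real (quad_coeff n'))"
    unfolding Suc using arg_cong[OF ell_Suc[of n'], of real] by simp
  also have "\<dots> = 2 * ((\<Sum>k\<le>n div 2. ?T n k) - (\<Sum>k\<le>n div 2. ?T n' k))"
    using Suc by (subst (1 2) quad_coeff_eq_powi[where K = "n div 2"]) (simp_all add: div_le_mono)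
  also have "\<dots> = (\<Sum>k\<le>n div 2. 2 * (?T n k - ?T n' k))"
    by (simp only: sum_subtractf right_diff_distrib sum_distrib_left)
  also have "\<dots> = (\<Sum>k\<le>n div 2. real (n choose k) * real ((n - k) choose k)
              * (real (n - 2 * k) * real (n + k + 2) / real (k + 1))
              * 2 ^ (k + 1) * (3::real) powi (int n - 2 * int k - 2))"
  proof (rule sum.cong[OF refl])
    fix k assume "k \<in> {..n div 2}"
    then have k: "2 * k \<le> n" by auto
    show "2 * (?T n k - ?T n' k) = real (n choose k) * real ((n - k) choose k)
              * (real (n - 2 * k) * real (n + k + 2) / real (k + 1))
              * 2 ^ (k + 1) * (3::real) powi (int n - 2 * int k - 2)"
    \<comment> \<open>For \<open>2 * k = n\<close> the difference n - 1 - 2 k would be -1, not a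
      natural number; both sides vanish there.\<close>
    proof (cases "2 * k = n")
      case True
      then have "(n + 1) choose (2 * k + 2) = 0" "(n' + 1) choose (2 * k + 2) = 0"
        using Suc by (auto intro!: binomial_eq_0 simp del: binomial_Suc_Suc)
      then show ?thesis using True by (simp only:) simp
    next
      case False
      define m where "m = n' - 2 * k"
      have m: "n' = 2 * k + m" "n = 2 * k + m + 1" using False k Suc by (auto simp: m_def)
      have e: "int n - 1 - 2 * int k = int m - 1 + 1" "int n' - 1 - 2 * int k = int m - 1"
        "int n - 2 * int k - 2 = int m - 1" using m by auto
      have p: "(3::real) powi (int m - 1 + 1) = 3 powi (int m - 1) * 3"
        by (rule power_int_add_1) simp
      have i: "n + 1 = 2 * k + m + 2" "n' + 1 = 2 * k + m + 1" "n - k = k + m + 1" "n - 2 * k = m + 1"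
        "n + k + 2 = 3 * k + m + 3"
        using m by auto
      have c: "real (n choose k) = real ((2 * k + m + 1) choose k)"
        by (simp only: m(2))
      have "2 * (?T n k - ?T n' k) = 2 * (real (central_coeff k) * real ((2 * k + m + 2) choose (2 * k + 2)) * 3
          - real (central_coeff k) * real ((2 * k + m + 1) choose (2 * k + 2))) * (2 ^ k * 3 powi (int m - 1))"
        unfolding e i p by (simp only: left_diff_distrib right_diff_distrib mult_ac)
      also have "\<dots> = real (n choose k) * real ((n - k) choose k)
              * (real (n - 2 * k) * real (n + k + 2) / real (k + 1))
              * 2 ^ (k + 1) * (3::real) powi (int n - 2 * int k - 2)"
        unfolding trinomial_term_eq e i c by (simp only: power_add power_one_right mult_ac)
      finally show ?thesis .
    qed
  qed
  finally show ?thesis by (simp only: atMost_atLeast0)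
qed

section \<open>Asymptotics\<close>

text \<open>These are the coefficients of \<open>(1 - y) powr (-3/2)\<close>, which grow only like
  \<open>sqrt n\<close>.\<close>

definition scaled_coeff :: "nat \<Rightarrow> real" where
  "scaled_coeff n = real (central_coeff n) / 4 ^ n"

lemma scaled_coeff_pos: "scaled_coeff n > 0"
  by (simp add: scaled_coeff_def central_coeff_pos)

lemma scaled_coeff_sums:
  assumes "\<bar>y\<bar> < 1"
  shows "(\<lambda>n. scaled_coeff n * y ^ n) sums (1 - y) powr (-3/2)"
  using central_coeff_sums[of "y / 4"] assms by (simp add: scaled_coeff_def power_divide)

lemma scaled_coeff_abs_summable:
  assumes "\<bar>y\<bar> < 1"
  shows "summable (\<lambda>n. norm (scaled_coeff n * y ^ n))"
  using scaled_coeff_sums[of "\<bar>y\<bar>"] scaled_coeff_pos assms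
  by (simp add: abs_mult power_abs less_imp_le sums_iff)

text \<open>Consecutive terms have the ratio (2 n + 3) / (2 n + 2). Monotonicity supplies the
  domination needed for exchanging limit and sum.\<close>

lemma incseq_scaled_coeff: "incseq scaled_coeff"
proof (rule incseq_SucI)
  fix n
  have "scaled_coeff (Suc n) = scaled_coeff n * ((2 * real n + 3) / (2 * real n + 2))"
  proof -
    have "2 * (2 * real n + 3) / (real n + 1) = 4 * ((2 * real n + 3) / (2 * real n + 2))"
      by (simp add: divide_simps) (simp add: algebra_simps)
    moreover have "c * (4 * r) / 4 ^ Suc n = c / 4 ^ n * r" for c r :: real
      by simp
    ultimately show ?thesis unfolding scaled_coeff_def central_coeff_Suc by (simp only:)
  qed
  moreover have "scaled_coeff n * 1 \<le> scaled_coeff n * ((2 * real n + 3) / (2 * real n + 2))"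
    by (intro mult_left_mono) (use scaled_coeff_pos[of n] in auto)
  ultimately show "scaled_coeff n \<le> scaled_coeff (Suc n)" by simp
qed

lemma scaled_coeff_over_sqrt_tendsto: "(\<lambda>n. scaled_coeff n / sqrt (real n)) \<longlonglongrightarrow> 2 / sqrt pi"
proof -
  have "1/2 \<notin> (\<int>\<^sub>\<le>\<^sub>0 :: real set)"
    using nonpos_Ints_nonpos[of "1/2 :: real"] by auto
  from Gamma_plus1[OF this] have Gamma: "Gamma (3/2 :: real) = sqrt pi / 2"
    by (simp add: Gamma_one_half_real)
  have "inverse (Gamma (3/2 :: real)) = 2 / sqrt pi"
    unfolding Gamma by simp
  then have "(\<lambda>n. (-3/2 gchoose n :: real) / ((-1)^n / exp ((-3/2 + 1) * ln (real n)))) \<longlonglongrightarrow> 2 / sqrt pi"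
    using gbinomial_asymptotic[of "-3/2 :: real"] by simp
  moreover have "eventually (\<lambda>n. (-3/2 gchoose n :: real) / ((-1)^n / exp ((-3/2 + 1) * ln (real n)))
      = scaled_coeff n / sqrt (real n)) sequentially"
    using eventually_gt_at_top[of 0]
  proof eventually_elim
    case (elim n)
    have "exp ((-3/2 + 1) * ln (real n)) = real n powr (-1/2)"
      using elim by (simp add: powr_def)
    also have "\<dots> = 1 / sqrt (real n)"
      using powr_minus_divide[of "real n" "1/2"] elim by (simp add: powr_half_sqrt)
    finally have e: "exp ((-3/2 + 1) * ln (real n)) = 1 / sqrt (real n)" .
    have "scaled_coeff n = (-3/2 gchoose n) * ((-4) ^ n / 4 ^ n)"
      by (simp add: scaled_coeff_def central_coeff_gbinomial)
    also have "(-4) ^ n / 4 ^ n = ((-1) ^ n :: real)"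
      by (simp flip: power_divide)
    finally have h: "scaled_coeff n = (-3/2 gchoose n) * (-1) ^ n" .
    show ?case unfolding e h by (cases "even n") simp_all
  qed
  ultimately show ?thesis by (rule Lim_transform_eventually)
qed

lemma scaled_coeff_shift_tendsto: "(\<lambda>n. scaled_coeff (n - i) / scaled_coeff n) \<longlonglongrightarrow> 1"
proof (rule LIMSEQ_offset[where k = i])
  have "(\<lambda>n. (scaled_coeff n / sqrt (real n)) / (scaled_coeff (n + i) / sqrt (real (n + i))) * sqrt (real n / real (n + i)))
      \<longlonglongrightarrow> (2 / sqrt pi) / (2 / sqrt pi) * 1"
  proof (rule tendsto_mult[OF tendsto_divide[OF scaled_coeff_over_sqrt_tendsto
          LIMSEQ_ignore_initial_segment[OF scaled_coeff_over_sqrt_tendsto]]])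
    show "(\<lambda>n. sqrt (real n / real (n + i))) \<longlonglongrightarrow> 1"
      unfolding of_nat_add by real_asymp
  qed simp
  moreover have "eventually (\<lambda>n. (scaled_coeff n / sqrt (real n)) / (scaled_coeff (n + i) / sqrt (real (n + i))) * sqrt (real n / real (n + i))
      = scaled_coeff (n + i - i) / scaled_coeff (n + i)) sequentially"
    using eventually_gt_at_top[of 0]
    by eventually_elim (simp add: real_sqrt_divide)
  ultimately show "(\<lambda>n. scaled_coeff (n + i - i) / scaled_coeff (n + i)) \<longlonglongrightarrow> 1"
    by (simp add: Lim_transform_eventually)
qed

section \<open>Factorisation of the quadratic and growth of its coefficients\<close>

definition root_hi :: real where "root_hi = 3 + 2 * sqrt 2"
definition root_lo :: real where "root_lo = 3 - 2 * sqrt 2"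

lemma root_hi_lo: "root_hi * root_lo = 1" "root_hi + root_lo = 6" "0 < root_lo" "root_lo < 1" "0 < root_hi"
  using radius_bounds by (simp_all add: root_hi_def root_lo_def algebra_simps add_pos_nonneg)

lemma quad_coeff_Suc_convolution: "real (quad_coeff (Suc n)) = (\<Sum>i\<le>n. (scaled_coeff i * root_lo ^ i) * (scaled_coeff (n - i) * root_hi ^ (n - i)))"
proof (rule powser_unique[OF root_hi_lo(3), where f = "\<lambda>x. (1 - 6 * x + x\<^sup>2) powr (-3/2)"])
  fix x :: real assume x: "\<bar>x\<bar> < root_lo"
  show "(\<lambda>n. real (quad_coeff (Suc n)) * x ^ n) sums (1 - 6 * x + x\<^sup>2) powr (-3/2)"
    using quad_coeff_Suc_sums[of x] x by (simp add: root_lo_def)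
  have "root_hi * \<bar>x\<bar> < root_hi * root_lo" using x root_hi_lo(5) by (rule mult_strict_left_mono)
  then have ax: "\<bar>root_hi * x\<bar> < 1" using root_hi_lo by (simp add: abs_mult)
  have "root_lo * \<bar>x\<bar> < 1 * 1" using x root_hi_lo by (intro mult_strict_mono) auto
  then have bx: "\<bar>root_lo * x\<bar> < 1" using root_hi_lo by (simp add: abs_mult)
  have "(\<lambda>n. \<Sum>i\<le>n. (scaled_coeff i * (root_lo * x) ^ i) * (scaled_coeff (n - i) * (root_hi * x) ^ (n - i)))
      sums ((\<Sum>i. scaled_coeff i * (root_lo * x) ^ i) * (\<Sum>i. scaled_coeff i * (root_hi * x) ^ i))"
    by (intro Cauchy_product_sums scaled_coeff_abs_summable ax bx)
  also have "(\<Sum>i. scaled_coeff i * (root_lo * x) ^ i) = (1 - root_lo * x) powr (-3/2)"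
    by (rule sums_unique[symmetric, OF scaled_coeff_sums[OF bx]])
  also have "(\<Sum>i. scaled_coeff i * (root_hi * x) ^ i) = (1 - root_hi * x) powr (-3/2)"
    by (rule sums_unique[symmetric, OF scaled_coeff_sums[OF ax]])
  also have "(1 - root_lo * x) powr (-3/2) * (1 - root_hi * x) powr (-3/2) = ((1 - root_lo * x) * (1 - root_hi * x)) powr (-3/2)"
    by (rule powr_mult[symmetric])
  also have "(1 - root_lo * x) * (1 - root_hi * x) = 1 - (root_hi + root_lo) * x + (root_hi * root_lo) * x\<^sup>2"
    by (simp add: algebra_simps power2_eq_square)
  also have "\<dots> = 1 - 6 * x + x\<^sup>2"
    by (simp add: root_hi_lo)
  finally have "(\<lambda>n. \<Sum>i\<le>n. (scaled_coeff i * (root_lo * x) ^ i) * (scaled_coeff (n - i) * (root_hi * x) ^ (n - i)))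
      sums (1 - 6 * x + x\<^sup>2) powr (-3/2)" .
  moreover have "(\<Sum>i\<le>n. (scaled_coeff i * (root_lo * x) ^ i) * (scaled_coeff (n - i) * (root_hi * x) ^ (n - i)))
      = (\<Sum>i\<le>n. (scaled_coeff i * root_lo ^ i) * (scaled_coeff (n - i) * root_hi ^ (n - i))) * x ^ n" for n
    unfolding sum_distrib_right
  proof (rule sum.cong[OF refl])
    fix i assume "i \<in> {..n}"
    then have "x ^ n = x ^ i * x ^ (n - i)" by (simp flip: power_add)
    then show "(scaled_coeff i * (root_lo * x) ^ i) * (scaled_coeff (n - i) * (root_hi * x) ^ (n - i))
      = (scaled_coeff i * root_lo ^ i) * (scaled_coeff (n - i) * root_hi ^ (n - i)) * x ^ n"
      by (simp only: power_mult_distrib mult_ac)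
  qed
  ultimately show "(\<lambda>n. (\<Sum>i\<le>n. (scaled_coeff i * root_lo ^ i) * (scaled_coeff (n - i) * root_hi ^ (n - i))) * x ^ n)
      sums (1 - 6 * x + x\<^sup>2) powr (-3/2)"
    by (simp only:)
qed

text \<open>The dominant singularity is at 1 / root_hi = root_lo, and the limit is the value there
  of the other factor \<open>(1 - root_lo * x) powr (-3/2)\<close>.\<close>

lemma quad_coeff_Suc_tendsto:
  "(\<lambda>n. real (quad_coeff (Suc n)) / (scaled_coeff n * root_hi ^ n)) \<longlonglongrightarrow> (1 - root_lo\<^sup>2) powr (-3/2)"
proof -
  \<comment> \<open>Since \<open>scaled_coeff\<close> is increasing, the summands are dominated by the terms of a convergent series.\<close>
  define a where "a = (\<lambda>i n. if i \<le> n then scaled_coeff i * (root_lo\<^sup>2) ^ i * (scaled_coeff (n - i) / scaled_coeff n) else 0)"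
  have be2: "\<bar>root_lo\<^sup>2\<bar> < 1"
    using root_hi_lo by (simp add: power_less_one_iff)
  have lim: "(\<lambda>n. a i n) \<longlonglongrightarrow> scaled_coeff i * (root_lo\<^sup>2) ^ i" for i
  proof (rule Lim_transform_eventually)
    show "(\<lambda>n. scaled_coeff i * (root_lo\<^sup>2) ^ i * (scaled_coeff (n - i) / scaled_coeff n)) \<longlonglongrightarrow> scaled_coeff i * (root_lo\<^sup>2) ^ i"
      using tendsto_mult[OF tendsto_const scaled_coeff_shift_tendsto, of "scaled_coeff i * (root_lo\<^sup>2) ^ i" i] by simp
    show "eventually (\<lambda>n. scaled_coeff i * (root_lo\<^sup>2) ^ i * (scaled_coeff (n - i) / scaled_coeff n) = a i n) sequentially"
      using eventually_ge_at_top[of i] by eventually_elim (simp add: a_def)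
  qed
  have "norm (a i n) \<le> scaled_coeff i * (root_lo\<^sup>2) ^ i" for i n
  proof (cases "i \<le> n")
    case True
    have "scaled_coeff (n - i) / scaled_coeff n \<le> 1"
      using incseqD[OF incseq_scaled_coeff, of "n - i" n] scaled_coeff_pos[of n] by simp
    then have "scaled_coeff i * (root_lo\<^sup>2) ^ i * (scaled_coeff (n - i) / scaled_coeff n) \<le> scaled_coeff i * (root_lo\<^sup>2) ^ i * 1"
      using scaled_coeff_pos[of i] by (intro mult_left_mono) auto
    then show ?thesis
      using scaled_coeff_pos[of i] scaled_coeff_pos[of n] scaled_coeff_pos[of "n - i"] True by (simp add: a_def abs_mult)
  qed (use scaled_coeff_pos[of i] in \<open>simp add: a_def\<close>)
  then have bound: "eventually (\<lambda>(i, n). norm (a i n) \<le> scaled_coeff i * (root_lo\<^sup>2) ^ i) (at_top \<times>\<^sub>F sequentially)"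
    by (intro always_eventually) auto
  have "summable (\<lambda>i. scaled_coeff i * (root_lo\<^sup>2) ^ i)"
    using scaled_coeff_sums[OF be2] by (rule sums_summable)
  from tannerys_theorem[OF lim bound this]
  have "(\<lambda>n. \<Sum>i. a i n) \<longlonglongrightarrow> (\<Sum>i. scaled_coeff i * (root_lo\<^sup>2) ^ i)"
    by simp
  also have "(\<Sum>i. scaled_coeff i * (root_lo\<^sup>2) ^ i) = (1 - root_lo\<^sup>2) powr (-3/2)"
    by (rule sums_unique[symmetric, OF scaled_coeff_sums[OF be2]])
  also have "(\<lambda>n. \<Sum>i. a i n) = (\<lambda>n. real (quad_coeff (Suc n)) / (scaled_coeff n * root_hi ^ n))"
  proof
    fix n
    have "(\<Sum>i. a i n) = (\<Sum>i\<le>n. a i n)"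
      by (rule suminf_finite) (auto simp: a_def)
    also have "\<dots> = (\<Sum>i\<le>n. (scaled_coeff i * root_lo ^ i) * (scaled_coeff (n - i) * root_hi ^ (n - i)) / (scaled_coeff n * root_hi ^ n))"
    proof (rule sum.cong[OF refl])
      fix i assume "i \<in> {..n}"
      then have i: "i \<le> n" by simp
      have "root_hi ^ n = root_hi ^ i * root_hi ^ (n - i)" using i by (simp flip: power_add)
      \<comment> \<open>Since \<open>root_hi * root_lo = 1\<close>, dividing by
        \<open>root_hi ^ n\<close> leaves the quotient root_lo / root_hi = root_lo^2 as
        base.\<close>
      moreover have "root_lo ^ i = (root_lo\<^sup>2) ^ i * root_hi ^ i"
      proof -
        have "root_lo\<^sup>2 * root_hi = root_lo" using root_hi_lo(1) by (simp add: power2_eq_square mult.assoc mult.commute)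
        then show ?thesis by (simp flip: power_mult_distrib)
      qed
      ultimately show "a i n = (scaled_coeff i * root_lo ^ i) * (scaled_coeff (n - i) * root_hi ^ (n - i)) / (scaled_coeff n * root_hi ^ n)"
        using i root_hi_lo by (simp add: a_def)
    qed
    finally show "(\<Sum>i. a i n) = real (quad_coeff (Suc n)) / (scaled_coeff n * root_hi ^ n)"
      by (simp only: quad_coeff_Suc_convolution sum_divide_distrib)
  qed
  finally show ?thesis .
qed

lemma quad_coeff_Suc_asymp:
  "(\<lambda>n. real (quad_coeff (Suc n)) / (sqrt (real n) * root_hi ^ n)) \<longlonglongrightarrow> (1 - root_lo\<^sup>2) powr (-3/2) * (2 / sqrt pi)"
proof -
  have "(\<lambda>n. real (quad_coeff (Suc n)) / (scaled_coeff n * root_hi ^ n) * (scaled_coeff n / sqrt (real n)))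
      \<longlonglongrightarrow> (1 - root_lo\<^sup>2) powr (-3/2) * (2 / sqrt pi)"
    by (intro tendsto_mult quad_coeff_Suc_tendsto scaled_coeff_over_sqrt_tendsto)
  moreover have "real (quad_coeff (Suc n)) / (scaled_coeff n * root_hi ^ n) * (scaled_coeff n / sqrt (real n))
      = real (quad_coeff (Suc n)) / (sqrt (real n) * root_hi ^ n)" for n
    using scaled_coeff_pos[of n] by simp
  ultimately show ?thesis by simp
qed

lemma quad_coeff_Suc_pos: "real (quad_coeff (Suc n)) > 0"
  unfolding quad_coeff_Suc_convolution using root_hi_lo scaled_coeff_pos by (intro sum_pos) auto

lemma root_lo_bound: "1 - root_lo\<^sup>2 > 0"
  using root_hi_lo by (simp add: power_less_one_iff)

text \<open>After normalisation consecutive values have the same nonzero limit, so only the quotient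
  1 / root_hi of the normalising powers survives.\<close>

lemma quad_coeff_ratio_tendsto: "(\<lambda>n. real (quad_coeff n) / real (quad_coeff (Suc n))) \<longlonglongrightarrow> root_lo"
proof (rule LIMSEQ_imp_Suc)
  define Y where "Y = (\<lambda>n. real (quad_coeff (Suc n)) / (scaled_coeff n * root_hi ^ n))"
  define L where "L = (1 - root_lo\<^sup>2) powr (-3/2)"
  have "L \<noteq> 0" using root_lo_bound by (simp add: L_def)
  have Y: "Y \<longlonglongrightarrow> L" unfolding Y_def L_def by (rule quad_coeff_Suc_tendsto)
  have h: "(\<lambda>n. scaled_coeff n / scaled_coeff (Suc n)) \<longlonglongrightarrow> 1"
    using LIMSEQ_Suc[OF scaled_coeff_shift_tendsto[of 1]] by simp
  have "(\<lambda>n. Y n / Y (Suc n) * (scaled_coeff n / scaled_coeff (Suc n)) * root_lo) \<longlonglongrightarrow> L / L * 1 * root_lo"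
    by (rule tendsto_mult[OF tendsto_mult[OF tendsto_divide[OF Y LIMSEQ_Suc[OF Y] \<open>L \<noteq> 0\<close>] h] tendsto_const])
  moreover have "Y n / Y (Suc n) * (scaled_coeff n / scaled_coeff (Suc n)) * root_lo = real (quad_coeff (Suc n)) / real (quad_coeff (Suc (Suc n)))" for n
  proof -
    have "Y n / Y (Suc n) * (scaled_coeff n / scaled_coeff (Suc n)) = real (quad_coeff (Suc n)) / real (quad_coeff (Suc (Suc n))) * root_hi"
      using scaled_coeff_pos[of n] scaled_coeff_pos[of "Suc n"] root_hi_lo(5) quad_coeff_Suc_pos[of "Suc n"] by (simp add: Y_def)
    then show ?thesis using root_hi_lo(1) by (simp add: mult.assoc)
  qed
  ultimately show "(\<lambda>n. real (quad_coeff (Suc n)) / real (quad_coeff (Suc (Suc n)))) \<longlonglongrightarrow> root_lo"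
    using \<open>L \<noteq> 0\<close> by simp
qed

lemma ell_quad_coeff_ratio_tendsto: "(\<lambda>n. real (ell (Suc n)) / real (quad_coeff (Suc n))) \<longlonglongrightarrow> 2 * (1 - root_lo)"
proof -
  have "(\<lambda>n. 2 * (1 - real (quad_coeff n) / real (quad_coeff (Suc n)))) \<longlonglongrightarrow> 2 * (1 - root_lo)"
    by (intro tendsto_intros quad_coeff_ratio_tendsto)
  moreover have "2 * (1 - real (quad_coeff n) / real (quad_coeff (Suc n))) = real (ell (Suc n)) / real (quad_coeff (Suc n))" for n
    using arg_cong[OF ell_Suc[of n], of real] quad_coeff_Suc_pos[of n] by (simp add: field_simps)
  ultimately show ?thesis by simp
qed

text \<open>The left side collects 2 (1 - root_lo) from \<open>ell\<close> over
  \<open>quad_coeff\<close>, the limit of the normalised \<open>quad_coeff\<close>, and one factor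
  root_lo from the index shift. After squaring, (1 - root_lo)^2 = 4 root_lo and 1 - root_lo^2 = 4
  sqrt 2 root_lo make all powers of root_lo cancel.\<close>

lemma asymptotic_constant:
  "4 * (1 - root_lo) * root_lo * (1 - root_lo\<^sup>2) powr (-3/2) / sqrt pi = sqrt (1 / (2 * sqrt 2 * pi))"
proof (rule real_sqrt_unique[symmetric])
  have 1: "(1 - root_lo)\<^sup>2 = 4 * root_lo"
    by (simp add: root_lo_def power2_eq_square algebra_simps)
  have 2: "1 - root_lo\<^sup>2 = 4 * sqrt 2 * root_lo"
    by (simp add: root_lo_def power2_eq_square algebra_simps)
  have 3: "((1 - root_lo\<^sup>2) powr (-3/2))\<^sup>2 = 1 / (1 - root_lo\<^sup>2) ^ 3"
  proof -
    have "((1 - root_lo\<^sup>2) powr (-3/2))\<^sup>2 = (1 - root_lo\<^sup>2) powr (-3/2) * (1 - root_lo\<^sup>2) powr (-3/2)"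
      by (rule power2_eq_square)
    also have "\<dots> = (1 - root_lo\<^sup>2) powr (- 3)"
      by (simp flip: powr_add)
    also have "\<dots> = 1 / (1 - root_lo\<^sup>2) ^ 3"
      using root_lo_bound by (simp add: powr_minus_divide)
    finally show ?thesis .
  qed
  have s: "sqrt 2 ^ 3 = 2 * sqrt 2" by (simp add: power3_eq_cube)
  have "(4 * (1 - root_lo) * root_lo * (1 - root_lo\<^sup>2) powr (-3/2) / sqrt pi)\<^sup>2
      = 16 * (1 - root_lo)\<^sup>2 * root_lo\<^sup>2 * ((1 - root_lo\<^sup>2) powr (-3/2))\<^sup>2 / pi"
    unfolding power_divide power_mult_distrib by simp
  also have "\<dots> = 16 * (4 * root_lo) * root_lo\<^sup>2 * (1 / (4 * sqrt 2 * root_lo) ^ 3) / pi"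
    unfolding 3 by (simp only: 1 2)
  also have "\<dots> = 1 / (2 * sqrt 2 * pi)"
    using root_hi_lo(3) by (simp add: power_mult_distrib s) (simp add: power2_eq_square power3_eq_cube)
  finally show "(4 * (1 - root_lo) * root_lo * (1 - root_lo\<^sup>2) powr (-3/2) / sqrt pi)\<^sup>2 = 1 / (2 * sqrt 2 * pi)" .
  show "0 \<le> 4 * (1 - root_lo) * root_lo * (1 - root_lo\<^sup>2) powr (-3/2) / sqrt pi"
    using root_hi_lo by simp
qed

lemma ell_asymp_equiv:
  "(\<lambda>n. real (ell n)) \<sim>[at_top] (\<lambda>n. sqrt (real n / (2 * sqrt 2 * pi)) * (1 + sqrt 2) ^ (2 * n))"
proof (rule asymp_equivI')
  define c where "c = sqrt (1 / (2 * sqrt 2 * pi))"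
  have c: "c > 0" by (simp add: c_def)
  have root_hi: "(1 + sqrt 2) ^ (2 * n) = root_hi ^ n" for n
  proof -
    have "(1 + sqrt 2)\<^sup>2 = root_hi" by (simp add: root_hi_def power2_eq_square algebra_simps)
    then show ?thesis unfolding power_mult by (simp only:)
  qed
  have sq: "sqrt (real n / (2 * sqrt 2 * pi)) = c * sqrt (real n)" for n
    by (simp add: c_def real_sqrt_divide real_sqrt_mult)
  \<comment> \<open>The last two factors change the normalisation
    \<open>sqrt n * root_hi ^ n\<close> into the claimed one at \<open>Suc n\<close>.\<close>
  have "(\<lambda>n. real (ell (Suc n)) / real (quad_coeff (Suc n)) * (real (quad_coeff (Suc n)) / (sqrt (real n) * root_hi ^ n))
        * sqrt (real n / real (Suc n)) * (root_lo / c))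
      \<longlonglongrightarrow> 2 * (1 - root_lo) * ((1 - root_lo\<^sup>2) powr (-3/2) * (2 / sqrt pi)) * 1 * (root_lo / c)"
  proof (rule tendsto_mult[OF tendsto_mult[OF tendsto_mult[OF ell_quad_coeff_ratio_tendsto quad_coeff_Suc_asymp]] tendsto_const])
    show "(\<lambda>n. sqrt (real n / real (Suc n))) \<longlonglongrightarrow> 1"
      unfolding of_nat_Suc by real_asymp
  qed
  also have "2 * (1 - root_lo) * ((1 - root_lo\<^sup>2) powr (-3/2) * (2 / sqrt pi)) * 1 * (root_lo / c)
      = (4 * (1 - root_lo) * root_lo * (1 - root_lo\<^sup>2) powr (-3/2) / sqrt pi) / c"
    by (simp only: times_divide_eq_left times_divide_eq_right mult_1_right mult_ac) simp
  also have "\<dots> = 1"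
    unfolding asymptotic_constant using c by (simp add: c_def)
  finally have lim: "(\<lambda>n. real (ell (Suc n)) / real (quad_coeff (Suc n)) * (real (quad_coeff (Suc n)) / (sqrt (real n) * root_hi ^ n))
        * sqrt (real n / real (Suc n)) * (root_lo / c)) \<longlonglongrightarrow> 1" .
  have ev: "eventually (\<lambda>n. real (ell (Suc n)) / real (quad_coeff (Suc n)) * (real (quad_coeff (Suc n)) / (sqrt (real n) * root_hi ^ n))
        * sqrt (real n / real (Suc n)) * (root_lo / c)
      = real (ell (Suc n)) / (sqrt (real (Suc n) / (2 * sqrt 2 * pi)) * (1 + sqrt 2) ^ (2 * Suc n))) sequentially"
    using eventually_gt_at_top[of 0]
  proof eventually_elim
    case (elim n)
    have root_lo: "root_lo = 1 / root_hi" using root_hi_lo by (simp add: field_simps)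
    show ?case
      unfolding root_hi sq unfolding real_sqrt_divide root_lo using c root_hi_lo(5) elim quad_coeff_Suc_pos[of n] by (simp del: of_nat_Suc)
  qed
  show "(\<lambda>n. real (ell n) / (sqrt (real n / (2 * sqrt 2 * pi)) * (1 + sqrt 2) ^ (2 * n))) \<longlonglongrightarrow> 1"
    by (rule LIMSEQ_imp_Suc, rule Lim_transform_eventually[OF lim ev])
qed

lemma ell_over_card_asymp_equiv:
  "(\<lambda>n. real (ell n) / real (card (GS n))) \<sim>[at_top] (\<lambda>n. (2 - sqrt 2) * real n)"
proof (rule asymp_equivI', rule LIMSEQ_imp_Suc)
  let ?r = "\<lambda>n. real (ell (Suc n)) / real (quad_coeff (Suc n))"
  have "2 * (1 - root_lo) + 4 \<noteq> 0" using root_hi_lo by simp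
  then have "(\<lambda>n. 2 * ?r n / (?r n + 4) / (2 - sqrt 2)) \<longlonglongrightarrow> 2 * (2 * (1 - root_lo)) / (2 * (1 - root_lo) + 4) / (2 - sqrt 2)"
    by (intro tendsto_intros ell_quad_coeff_ratio_tendsto) (auto simp: real_sqrt_eq_iff dest: arg_cong[of _ _ "\<lambda>x. x\<^sup>2"])
  moreover have "2 * (2 * (1 - root_lo)) / (2 * (1 - root_lo) + 4) / (2 - sqrt 2) = 1"
  proof -
    have "sqrt 2 < 2" by (rule real_less_lsqrt) auto
    moreover have "2 * (2 * (1 - root_lo)) = (2 - sqrt 2) * (2 * (1 - root_lo) + 4)"
      by (simp add: root_lo_def algebra_simps)
    ultimately show ?thesis using \<open>2 * (1 - root_lo) + 4 \<noteq> 0\<close> by simp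
  qed
  moreover have "2 * ?r n / (?r n + 4) / (2 - sqrt 2) = real (ell (Suc n)) / real (card (GS (Suc n))) / ((2 - sqrt 2) * real (Suc n))" for n
  proof -
    have g: "real (quad_coeff (Suc n)) > 0" by (rule quad_coeff_Suc_pos)
    have e: "real (ell (Suc n)) + 4 * real (quad_coeff (Suc n)) = 2 * real (Suc n) * real (card (GS (Suc n)))"
      using arg_cong[OF mult_card_GS[of "Suc n"], of real] by (simp only: of_nat_add of_nat_mult of_nat_numeral)
    \<comment> \<open>Dividing by \<open>quad_coeff\<close> expresses the ratio through
      \<open>?r\<close> alone, whose limit is known.\<close>
    have "2 * ?r n / (?r n + 4) = 2 * real (ell (Suc n)) / (real (ell (Suc n)) + 4 * real (quad_coeff (Suc n)))"
      using g by (simp add: field_simps)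
    also have "\<dots> = real (ell (Suc n)) / (real (Suc n) * real (card (GS (Suc n))))"
      unfolding e by (simp del: of_nat_Suc)
    finally show ?thesis by (simp only: divide_divide_eq_left mult_ac)
  qed
  ultimately show "(\<lambda>n. real (ell (Suc n)) / real (card (GS (Suc n))) / ((2 - sqrt 2) * real (Suc n))) \<longlonglongrightarrow> 1"
    by (simp only:)
qed

theorem mainTheorem15:
  shows "(\<forall>x::real. \<bar>x\<bar> < 3 - 2 * sqrt 2 \<longrightarrow>
           (\<lambda>n. real (ell n) * x ^ n) sums (2 * (x - x\<^sup>2) / (1 - 6 * x + x\<^sup>2) powr (3 / 2))) \<and>
         (\<forall>n. ell n = 2 * (\<Sum>k = 0..n. ((n + k) choose (2 * k)) * ((2 * k) choose k) * (n - k))) \<and>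
         (\<forall>n. real (ell n) =
           (\<Sum>k = 0..n div 2. real (n choose k) * real ((n - k) choose k)
              * (real (n - 2 * k) * real (n + k + 2) / real (k + 1))
              * 2 ^ (k + 1) * (3::real) powi (int n - 2 * int k - 2))) \<and>
         ((\<lambda>n. real (ell n)) \<sim>[at_top]
           (\<lambda>n. sqrt (real n / (2 * sqrt 2 * pi)) * (1 + sqrt 2) ^ (2 * n))) \<and>
         ((\<lambda>n. real (ell n) / real (card (GS n))) \<sim>[at_top] (\<lambda>n. (2 - sqrt 2) * real n))"
  using ell_sums ell_eq ell_eq_trinomial_sum ell_asymp_equiv ell_over_card_asymp_equiv
  by (simp only: atMost_atLeast0) blast

end
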